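(* Let $n \ge 1$, let $K \subset \mathbb{R}$ be compact, and suppose $\Gamma = (f_1,g_1,\dots,f_n,g_n,h) : K \to \mathbb{H}^n = \mathbb{R}^{2n+1}$ is of Whitney class $\mathfrak{C}^1(K,\mathbb{R}^{2n+1})$ with Whitney derivative $\Gamma' = (f_1',g_1',\dots,f_n',g_n',h') : K \to \mathbb{R}^{2n+1}$. Then there is a horizontal $C^1$ curve $\tilde{\Gamma} : \mathbb{R} \to \mathbb{H}^n$ such that $\tilde{\Gamma}|_K = \Gamma$ and $\tilde{\Gamma}'|_K = \Gamma'$ if and only if both $$\lim_{\substack{|b-a| \to 0 \\ a,b \in K}} \frac{\left| h(b)-h(a) - 2 \sum_{j=1}^n (f_j(b)g_j(a) - f_j(a)g_j(b)) \right|}{|b-a|^2} = 0$$ and $$h'(s)=2 \sum_{j=1}^n \left(f_j'(s)g_j(s)-g_j'(s)f_j(s) \right) \quad \text{for every } s \in K.$$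
   Context: Whitney class: for $K \subset \mathbb{R}$ compact, a continuous map $\Gamma : K \to \mathbb{R}^{N}$ is of Whitney class $\mathfrak{C}^1(K,\mathbb{R}^{N})$ with Whitney derivative $\Gamma'$ if $\Gamma' : K \to \mathbb{R}^N$ is a continuous map with $$\lim_{\substack{|b-a| \to 0 \\ a,b \in K}} \frac{|\Gamma(b)-\Gamma(a)-(b-a)\Gamma'(a)|}{|b-a|} = 0.$$ (Here $\Gamma'$ and its components $f_j', g_j', h'$ are just given continuous functions on $K$, a priori unrelated to classical derivatives.) Limits as $|b-a|\to 0$ with $a,b\in K$ are uniform: for every $\varepsilon>0$ there is $\delta>0$ such that the quantity is less than $\varepsilon$ for all $a,b \in K$ with $0<|b-a|<\delta$. Heisenberg group: $\mathbb{H}^n$ is $\mathbb{R}^{2n+1}$ with coordinates $(x_1,y_1,\dots,x_n,y_n,t)$. Its horizontal distribution is the span of $X_j = \partial_{x_j} + 2y_j\partial_t$, $Y_j = \partial_{y_j} - 2x_j \partial_t$, $j=1,\dots,n$. A $C^1$ curve $\tilde\Gamma = (\tilde f_1,\tilde g_1,\dots,\tilde f_n,\tilde g_n,\tilde h) : \mathbb{R}\to\mathbb{R}^{2n+1}$ is horizontal if $\tilde\Gamma'(s)$ lies in the horizontal space at $\tilde\Gamma(s)$ for every $s$, equivalently $\tilde h'(s) = 2\sum_{j=1}^n(\tilde f_j'(s)\tilde g_j(s) - \tilde f_j(s)\tilde g_j'(s))$ for every $s\in\mathbb{R}$. "$C^1$" is meant in the usual Euclidean sense. *)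

theory Defs
  imports "HOL-Analysis.Analysis"
begin

text \<open>
  The point with coordinates \<open>(x\<^sub>1, y\<^sub>1, \<dots>, x\<^sub>n, y\<^sub>n, t)\<close> of \<open>\<real>\<^bsup>2n+1\<^esup>\<close> is the pair of the vector of the
  \<open>(x\<^sub>j, y\<^sub>j)\<close> and \<open>t\<close>, with \<open>n = CARD('n)\<close>.  The norms on products and on finite Cartesian
  products are the \<open>L2\<close> ones, so the norm of this type is the Euclidean norm of \<open>\<real>\<^bsup>2n+1\<^esup>\<close>.
\<close>

type_synonym 'n heisenberg = "((real \<times> real) ^ 'n) \<times> real"

definition x_coord :: "'n::finite \<Rightarrow> 'n heisenberg \<Rightarrow> real" where
  "x_coord j p = fst (fst p $ j)"

definition y_coord :: "'n::finite \<Rightarrow> 'n heisenberg \<Rightarrow> real" where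
  "y_coord j p = snd (fst p $ j)"

definition t_coord :: "'n::finite heisenberg \<Rightarrow> real" where
  "t_coord p = snd p"

definition X_field :: "'n::finite \<Rightarrow> 'n heisenberg \<Rightarrow> 'n heisenberg" where
  "X_field j p = (axis j (1, 0), 2 * y_coord j p)"

definition Y_field :: "'n::finite \<Rightarrow> 'n heisenberg \<Rightarrow> 'n heisenberg" where
  "Y_field j p = (axis j (0, 1), - 2 * x_coord j p)"

definition horizontal_space :: "'n::finite heisenberg \<Rightarrow> 'n heisenberg set" where
  "horizontal_space p = span (range (\<lambda>j. X_field j p) \<union> range (\<lambda>j. Y_field j p))"

definition horizontal_C1_curve :: "(real \<Rightarrow> 'n::finite heisenberg) \<Rightarrow> bool" where
  "horizontal_C1_curve \<gamma> \<longleftrightarrow>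
     \<gamma> C1_differentiable_on UNIV \<and>
     (\<forall>s. vector_derivative \<gamma> (at s) \<in> horizontal_space (\<gamma> s))"

text \<open>\<open>q a b \<rightarrow> 0\<close> as \<open>\<bar>b - a\<bar> \<rightarrow> 0\<close> with \<open>a, b \<in> K\<close>, uniformly and off the diagonal.\<close>

definition vanishes_at_diagonal :: "real set \<Rightarrow> (real \<Rightarrow> real \<Rightarrow> real) \<Rightarrow> bool" where
  "vanishes_at_diagonal K q \<longleftrightarrow>
     (\<forall>\<epsilon>>0. \<exists>\<delta>>0. \<forall>a\<in>K. \<forall>b\<in>K. 0 < \<bar>b - a\<bar> \<and> \<bar>b - a\<bar> < \<delta> \<longrightarrow> \<bar>q a b\<bar> < \<epsilon>)"

definition whitney_C1 ::
  "real set \<Rightarrow> (real \<Rightarrow> 'a::real_normed_vector) \<Rightarrow> (real \<Rightarrow> 'a) \<Rightarrow> bool" where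
  "whitney_C1 K \<Gamma> \<Gamma>' \<longleftrightarrow>
     continuous_on K \<Gamma> \<and> continuous_on K \<Gamma>' \<and>
     vanishes_at_diagonal K (\<lambda>a b. norm (\<Gamma> b - \<Gamma> a - (b - a) *\<^sub>R \<Gamma>' a) / \<bar>b - a\<bar>)"

lemma horizontal_space_iff:
  fixes v p :: "'n::finite heisenberg"
  shows "v \<in> horizontal_space p \<longleftrightarrow>
     t_coord v = 2 * (\<Sum>j\<in>UNIV. x_coord j v * y_coord j p - x_coord j p * y_coord j v)"
    (is "_ \<longleftrightarrow> ?H v")
proof
  assume "v \<in> horizontal_space p"
  then have "v \<in> span (range (\<lambda>j. X_field j p) \<union> range (\<lambda>j. Y_field j p))"
    by (simp add: horizontal_space_def)
  then show "?H v"
  proof (induction rule: span_induct_alt)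
    case base
    show ?case by (simp add: x_coord_def y_coord_def t_coord_def)
  next
    case (step c u w)
    have 1: "fst (axis i (a, b) $ j) = (if j = i then a else (0::real))" 
            "snd (axis i (a, b) $ j) = (if j = i then b else (0::real))" for i j :: 'n and a b
      by (auto simp: axis_def)
    have "?H u"
      using step(1) by (auto simp: X_field_def Y_field_def x_coord_def y_coord_def t_coord_def 1
          if_distrib[of "\<lambda>x. x * _"] if_distrib[of "\<lambda>x. _ * x"] sum_subtractf cong: if_cong)
    have "(\<Sum>j\<in>UNIV. x_coord j (c *\<^sub>R u + w) * y_coord j p - x_coord j p * y_coord j (c *\<^sub>R u + w))
        = c * (\<Sum>j\<in>UNIV. x_coord j u * y_coord j p - x_coord j p * y_coord j u)
          + (\<Sum>j\<in>UNIV. x_coord j w * y_coord j p - x_coord j p * y_coord j w)"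
      unfolding sum_distrib_left sum.distrib[symmetric]
      by (simp add: x_coord_def y_coord_def algebra_simps)
    with \<open>?H u\<close> step(2) show ?case
      by (simp add: t_coord_def algebra_simps)
  qed
next
  assume H: "?H v"
  have "v = (\<Sum>j\<in>UNIV. x_coord j v *\<^sub>R X_field j p + y_coord j v *\<^sub>R Y_field j p)"
    (is "_ = ?S")
  proof (rule prod_eqI)
    have "fst v $ i = (\<Sum>j\<in>UNIV. x_coord j v *\<^sub>R axis j (1, 0) + y_coord j v *\<^sub>R axis j (0, 1)) $ i" for i
    proof -
      have "(x_coord j v *\<^sub>R axis j (1, 0) + y_coord j v *\<^sub>R axis j (0, 1)) $ i
          = (if j = i then fst v $ i else 0)" for j
        by (auto simp: axis_def x_coord_def y_coord_def prod_eq_iff)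
      then show ?thesis by (simp add: sum_component)
    qed
    then show "fst v = fst ?S"
      by (simp add: vec_eq_iff fst_sum X_field_def Y_field_def)
    show "snd v = snd ?S"
      using H by (simp add: t_coord_def snd_sum X_field_def Y_field_def sum_distrib_left
          algebra_simps)
  qed
  also have "\<dots> \<in> horizontal_space p"
    unfolding horizontal_space_def
    by (intro span_sum span_add span_scale span_base) auto
  finally show "v \<in> horizontal_space p" .
qed

end

(*
  Write a point of the Heisenberg group as (z, t), and let \<omega> be the symplectic form for which a curve
  (f, k) is horizontal iff k' = \<omega> f' f.  Along a horizontal curve the function
  s \<mapsto> k s - k a - \<omega> (f s) (f a) has derivative \<omega> (f' s) (f s - f a - (s - a) f' s), because
  \<omega> is alternating; this is o(s - a), and the mean value theorem gives the area condition.

  Conversely, on each gap (a, b) of K the cubic Hermite interpolant of f has derivative close to f' a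
  and has the wrong height at b only by o((b - a)^2).  Adding \<eta> (b - a) times a fixed closed loop in a
  plane on which \<omega> is nondegenerate changes the height by (b - a)^2 (\<eta> \<lambda> - \<sigma> c \<eta>^2), where \<sigma> is the
  orientation of the loop.  For suitable signs of \<sigma> and \<eta> both terms push in the desired direction,
  so some \<eta> = o(1) corrects the height, whatever \<lambda> is.  The resulting curve has a continuous derivative,
  and the heights of the gap curves glue because their derivative \<omega> f' f is then continuous as well.
*)

theory Submission
  imports Defs
begin

section \<open>Gluing across the gaps of a closed set\<close>

text \<open>Among the points of \<open>K\<close> on the segment take the one nearest to
  \<open>s\<close>; a point of \<open>K\<close> strictly between it and \<open>s\<close> would be
  nearer still. As segments carry no order, this finds the left and the right end of a gap
  alike.\<close>

lemma closed_nearest_on_segment: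
  fixes x s :: real
  assumes "closed K" "x \<in> K"
  obtains a where "a \<in> K" "a \<in> closed_segment x s" "open_segment a s \<inter> K = {}"
proof -
  have "closed (K \<inter> closed_segment x s)" "K \<inter> closed_segment x s \<noteq> {}"
    using assms by auto
  then obtain a where a: "a \<in> K \<inter> closed_segment x s"
    and min: "\<And>y. y \<in> K \<inter> closed_segment x s \<Longrightarrow> dist s a \<le> dist s y"
    by (rule distance_attains_inf) blast
  have "z \<notin> K" if z: "z \<in> open_segment a s" for z
  proof
    assume "z \<in> K"
    moreover have "z \<in> closed_segment x s" "dist s z < dist s a"
      using z a by (auto simp: closed_segment_eq_real_ivl open_segment_eq_real_ivl dist_real_def split: if_splits)
    ultimately show False using min[of z] by auto
  qed
  with a that show thesis by blast
qed

text \<open>For \<open>x\<close> in \<open>K\<close>, travel from \<open>x\<close> to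
  \<open>s\<close> by way of the point \<open>a\<close> of \<open>K\<close> on the segment nearest
  to \<open>s\<close>. The derivative along \<open>K\<close> controls the way to \<open>a\<close>, a
  mean value estimate over the gap controls the rest, and continuity of \<open>g\<close> compares
  \<open>g a\<close> with \<open>g x\<close>.\<close>

lemma has_vector_derivative_glue:
  fixes f g :: "real \<Rightarrow> 'a::real_normed_vector"
  assumes K: "closed K" and cont: "continuous_on UNIV g"
    and gap: "\<And>c d s. c < d \<Longrightarrow> {c<..<d} \<inter> K = {} \<Longrightarrow> s \<in> {c..d} \<Longrightarrow>
      (f has_vector_derivative g s) (at s within {c..d})"
    and der: "\<And>x. x \<in> K \<Longrightarrow> (f has_vector_derivative g x) (at x within K)"
  shows "(f has_vector_derivative g x) (at x)"
proof (cases "x \<in> K")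
  case False
  then obtain e where e: "e > 0" "ball x e \<subseteq> - K"
    using K open_contains_ball[of "- K"] by (auto simp: open_Compl)
  have "{x - e<..<x + e} = ball x e"
    using e by (auto simp: dist_real_def)
  then have "(f has_vector_derivative g x) (at x within {x - e..x + e})"
    using e by (intro gap) auto
  moreover have "at x within {x - e..x + e} = at x"
    using e by (intro at_within_interior) auto
  ultimately show ?thesis by simp
next
  case True
  show ?thesis
    unfolding has_vector_derivative_def has_derivative_within_alt
  proof (intro conjI allI impI)
    show "bounded_linear (\<lambda>h. h *\<^sub>R g x)" by (rule bounded_linear_scaleR_left)
    fix \<epsilon> :: real assume "\<epsilon> > 0"
    \<comment> \<open>The errors are \<open>e * \<bar>a - x\<bar>\<close> along \<open>K\<close>,
      \<open>2 * e * \<bar>s - a\<bar>\<close> across the gap and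
      \<open>e * \<bar>s - a\<bar>\<close> for replacing \<open>g a\<close> by \<open>g x\<close>.
      The two lengths add up to \<open>\<bar>s - x\<bar>\<close>, so a third of
      \<open>\<epsilon>\<close> suffices.\<close>
    define e where "e = \<epsilon> / 3"
    have e: "e > 0" using \<open>\<epsilon> > 0\<close> by (simp add: e_def)
    obtain d1 where d1: "d1 > 0" "\<And>y. dist y x < d1 \<Longrightarrow> dist (g y) (g x) < e"
      using cont e unfolding continuous_on_iff by blast
    obtain d2 where d2: "d2 > 0"
      "\<And>y. y \<in> K \<Longrightarrow> norm (y - x) < d2 \<Longrightarrow> norm (f y - f x - (y - x) *\<^sub>R g x) \<le> e * norm (y - x)"
      using der[OF True] e unfolding has_vector_derivative_def has_derivative_within_alt by blast
    show "\<exists>d>0. \<forall>y\<in>UNIV. norm (y - x) < d \<longrightarrow>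
        norm (f y - f x - (y - x) *\<^sub>R g x) \<le> \<epsilon> * norm (y - x)"
    proof (intro exI[of _ "min d1 d2"] conjI ballI impI)
      fix s assume s: "norm (s - x) < min d1 d2"
      obtain a where a: "a \<in> K" "a \<in> closed_segment x s" "open_segment a s \<inter> K = {}"
        using closed_nearest_on_segment[OF K True] by blast
      have len: "\<bar>s - a\<bar> + \<bar>a - x\<bar> = \<bar>s - x\<bar>"
        using a(2) by (auto simp: closed_segment_eq_real_ivl split: if_splits)
      have near: "norm (g y - g x) \<le> e" if "y \<in> closed_segment a s" for y
      proof -
        have "dist y x < d1"
          using that a(2) s by (auto simp: closed_segment_eq_real_ivl dist_real_def split: if_splits)
        from d1(2)[OF this] show ?thesis by (simp add: dist_norm)
      qed
      have "norm (f s - f a - (s - a) *\<^sub>R g a) \<le> norm (s - a) * (2 * e)" if "a \<noteq> s"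
      proof (rule vector_differentiable_bound_linearization[where S = "closed_segment a s"])
        fix y assume y: "y \<in> closed_segment a s"
        show "(f has_vector_derivative g y) (at y within closed_segment a s)"
          using gap[of a s y] gap[of s a y] a(3) y \<open>a \<noteq> s\<close>
          by (simp add: closed_segment_eq_real_ivl open_segment_eq_real_ivl split: if_splits)
        have "g y - g a = (g y - g x) - (g a - g x)" by simp
        then show "norm (g y - g a) \<le> 2 * e"
          using near[OF y] near[of a] norm_triangle_ineq4[of "g y - g x" "g a - g x"] by simp
      qed auto
      then have "norm (f s - f a - (s - a) *\<^sub>R g a) \<le> norm (s - a) * (2 * e)" by (cases "a = s") auto
      moreover have "norm (f a - f x - (a - x) *\<^sub>R g x) \<le> e * \<bar>a - x\<bar>"
      proof -
        have "norm (a - x) < d2" using len s unfolding real_norm_def by linarith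
        from d2(2)[OF a(1) this] show ?thesis by simp
      qed
      moreover have "norm ((s - a) *\<^sub>R (g a - g x)) \<le> \<bar>s - a\<bar> * e"
        using near[of a] by (simp add: mult_left_mono)
      moreover have "f s - f x - (s - x) *\<^sub>R g x = (f s - f a - (s - a) *\<^sub>R g a)
          + (f a - f x - (a - x) *\<^sub>R g x) + (s - a) *\<^sub>R (g a - g x)"
        by (simp add: algebra_simps)
      ultimately have "norm (f s - f x - (s - x) *\<^sub>R g x)
          \<le> \<bar>s - a\<bar> * (2 * e) + e * \<bar>a - x\<bar> + \<bar>s - a\<bar> * e"
        using norm_triangle_mono[OF norm_triangle_mono] by (metis real_norm_def)
      also have "\<dots> \<le> 3 * e * (\<bar>s - a\<bar> + \<bar>a - x\<bar>)"
        using e by (simp add: algebra_simps)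
      finally show "norm (f s - f x - (s - x) *\<^sub>R g x) \<le> \<epsilon> * norm (s - x)"
        by (simp add: len e_def)
    qed (use d1 d2 in auto)
  qed
qed

text \<open>At a point of \<open>K\<close> each side is treated separately. Either a gap starts
  there, and continuity on the closed gap applies, or \<open>K\<close> accumulates from that side,
  so that nearby gaps are short and \<open>small\<close> ties \<open>g\<close> inside them to its
  values on \<open>K\<close>.\<close>

lemma continuous_on_glue:
  fixes g :: "real \<Rightarrow> 'a::real_normed_vector"
  assumes K: "closed K" and contK: "continuous_on K g"
    and gap: "\<And>c d. c < d \<Longrightarrow> {c<..<d} \<inter> K = {} \<Longrightarrow> continuous_on {c..d} g"
    and small: "\<And>\<epsilon>. \<epsilon> > 0 \<Longrightarrow> \<exists>\<delta>>0. \<forall>a\<in>K. \<forall>b\<in>K. a < b \<longrightarrow> b < a + \<delta> \<longrightarrow> {a<..<b} \<inter> K = {} \<longrightarrow>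
      (\<forall>s\<in>{a..b}. dist (g s) (g a) < \<epsilon>)"
  shows "continuous_on UNIV g"
proof -
  \<comment> \<open>The point \<open>y\<close> merely selects the side of \<open>x\<close>; it
    becomes \<open>x + 1\<close> and \<open>x - 1\<close> below.\<close>
  have one_sided: "\<exists>\<delta>>0. \<forall>s\<in>closed_segment x y. dist s x < \<delta> \<longrightarrow> dist (g s) (g x) < \<epsilon>"
    if x: "x \<in> K" and "y \<noteq> x" and \<epsilon>: "\<epsilon> > 0" for x y \<epsilon>
  proof (cases "\<exists>z\<in>closed_segment x y. z \<noteq> x \<and> open_segment x z \<inter> K = {}")
    case True
    then obtain z where z: "z \<in> closed_segment x y" "z \<noteq> x" "open_segment x z \<inter> K = {}" by blast
    have "continuous_on (closed_segment x z) g"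
      using gap[of x z] gap[of z x] z(2,3)
      by (simp add: closed_segment_eq_real_ivl open_segment_eq_real_ivl split: if_splits)
    then obtain d where d: "d > 0"
      "\<And>s. s \<in> closed_segment x z \<Longrightarrow> dist s x < d \<Longrightarrow> dist (g s) (g x) < \<epsilon>"
      using \<epsilon> ends_in_segment(1)[of x z] unfolding continuous_on_iff by blast
    have "s \<in> closed_segment x z" if "s \<in> closed_segment x y" "dist s x < dist z x" for s
      using that z(1) by (auto simp: closed_segment_eq_real_ivl dist_real_def split: if_splits)
    then show ?thesis
      using d z(2) by (intro exI[of _ "min d (dist z x)"]) auto
  next
    case False
    have \<epsilon>3: "\<epsilon> / 3 > 0" using \<epsilon> by simp
    obtain d1 where d1: "d1 > 0" "\<And>s. s \<in> K \<Longrightarrow> dist s x < d1 \<Longrightarrow> dist (g s) (g x) < \<epsilon> / 3"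
      using contK x \<epsilon>3 unfolding continuous_on_iff by blast
    obtain d2 where d2: "d2 > 0" "\<And>a b s. a \<in> K \<Longrightarrow> b \<in> K \<Longrightarrow> a < b \<Longrightarrow> b < a + d2 \<Longrightarrow>
        {a<..<b} \<inter> K = {} \<Longrightarrow> s \<in> {a..b} \<Longrightarrow> dist (g s) (g a) < \<epsilon> / 3"
      using small[of "\<epsilon> / 3"] \<epsilon> by (metis divide_pos_pos zero_less_numeral)
    define d where "d = min (min d1 d2) (dist y x)"
    have d: "d > 0" using d1 d2 \<open>y \<noteq> x\<close> by (simp add: d_def)
    have "d \<le> dist y x" by (simp add: d_def)
    \<comment> \<open>A point \<open>k\<close> of \<open>K\<close> lies between \<open>x\<close> and
      \<open>z\<close>, hence within \<open>d\<close> of \<open>x\<close>. Any point between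
      \<open>x\<close> and \<open>k\<close> outside \<open>K\<close> then sits in a gap shorter than
      \<open>d\<close>, to which the choice of \<open>d2\<close> applies.\<close>
    define z where "z = (if x < y then x + d / 2 else x - d / 2)"
    have "z \<in> closed_segment x y" "z \<noteq> x" and zd: "dist z x < d"
      using d \<open>d \<le> dist y x\<close> unfolding z_def by (auto simp: closed_segment_eq_real_ivl dist_real_def)
    then obtain k where k: "k \<in> open_segment x z" "k \<in> K" using False by blast
    show ?thesis
    proof (intro exI[of _ "dist k x"] conjI ballI impI)
      show "dist k x > 0" using k(1) by (auto simp: open_segment_def)
      fix s assume s: "s \<in> closed_segment x y" "dist s x < dist k x"
      have sk: "s \<in> closed_segment x k" and kd: "dist k x < d"
        using s k \<open>z \<in> closed_segment x y\<close> zd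
        by (auto simp: closed_segment_eq_real_ivl open_segment_eq_real_ivl dist_real_def split: if_splits)
      show "dist (g s) (g x) < \<epsilon>"
      proof (cases "s \<in> K")
        case True
        then have "dist (g s) (g x) < \<epsilon> / 3" using d1(2) s(2) kd by (simp add: d_def)
        then show ?thesis using \<epsilon> by simp
      next
        case False
        obtain a where a: "a \<in> K" "a \<in> closed_segment x s" "open_segment a s \<inter> K = {}"
          using closed_nearest_on_segment[OF K x] by blast
        obtain b where b: "b \<in> K" "b \<in> closed_segment k s" "open_segment b s \<inter> K = {}"
          using closed_nearest_on_segment[OF K k(2)] by blast
        have "a \<noteq> s" "b \<noteq> s" using a b False by auto
        then have order: "x \<le> a \<and> a < s \<and> s < b \<and> b \<le> k \<or> k \<le> b \<and> b < s \<and> s < a \<and> a \<le> x"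
          using a(2) b(2) sk by (simp add: closed_segment_eq_real_ivl split: if_splits)
        \<comment> \<open>\<open>small\<close> measures from the left end of a gap. To the right of
          \<open>x\<close> this is the end nearer to \<open>x\<close>, to the left of
          \<open>x\<close> the farther one, so \<open>a\<close> and \<open>b\<close> exchange
          roles.\<close>
        obtain l r where lr: "l \<in> K" "r \<in> K" "l < s" "s < r" "{l<..<r} \<inter> K = {}"
          "dist l x < d" "r < l + d"
          using order
        proof
          assume o: "x \<le> a \<and> a < s \<and> s < b \<and> b \<le> k"
          then have "{a<..<b} \<subseteq> open_segment a s \<union> open_segment b s \<union> {s}"
            by (auto simp: open_segment_eq_real_ivl)
          then have "{a<..<b} \<inter> K = {}" using a(3) b(3) False by blast
          with o kd show ?thesis by (intro that[OF a(1) b(1)]) (auto simp: dist_real_def)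
        next
          assume o: "k \<le> b \<and> b < s \<and> s < a \<and> a \<le> x"
          then have "{b<..<a} \<subseteq> open_segment a s \<union> open_segment b s \<union> {s}"
            by (auto simp: open_segment_eq_real_ivl)
          then have "{b<..<a} \<inter> K = {}" using a(3) b(3) False by blast
          with o kd show ?thesis by (intro that[OF b(1) a(1)]) (auto simp: dist_real_def)
        qed
        then have "dist (g s) (g l) < \<epsilon> / 3"
          using d2(2)[OF lr(1,2) _ _ lr(5), of s] by (simp add: d_def)
        moreover have "dist (g l) (g x) < \<epsilon> / 3" using d1(2)[OF lr(1)] lr(6) by (simp add: d_def)
        ultimately show ?thesis using dist_triangle[of "g s" "g x" "g l"] \<epsilon> by simp
      qed
    qed
  qed
  have "isCont g x" for x
  proof (cases "x \<in> K")
    case False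
    then obtain e where e: "e > 0" "ball x e \<subseteq> - K"
      using K open_contains_ball[of "- K"] by (auto simp: open_Compl)
    have "{x - e<..<x + e} = ball x e"
      using e by (auto simp: dist_real_def)
    then have "continuous_on {x - e..x + e} g"
      using e by (intro gap) auto
    then show ?thesis
      using e by (intro continuous_on_interior) auto
  next
    case True
    show ?thesis
      unfolding continuous_at_eps_delta
    proof (intro allI impI)
      fix \<epsilon> :: real assume \<epsilon>: "\<epsilon> > 0"
      obtain d1 where d1: "d1 > 0" "\<forall>s\<in>closed_segment x (x + 1). dist s x < d1 \<longrightarrow> dist (g s) (g x) < \<epsilon>"
        using one_sided[OF True _ \<epsilon>, of "x + 1"] by auto
      obtain d2 where d2: "d2 > 0" "\<forall>s\<in>closed_segment x (x - 1). dist s x < d2 \<longrightarrow> dist (g s) (g x) < \<epsilon>"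
        using one_sided[OF True _ \<epsilon>, of "x - 1"] by auto
      have "s \<in> closed_segment x (x + 1) \<or> s \<in> closed_segment x (x - 1)" if "dist s x < 1" for s
        using that by (auto simp: closed_segment_eq_real_ivl dist_real_def)
      then show "\<exists>d>0. \<forall>s. dist s x < d \<longrightarrow> dist (g s) (g x) < \<epsilon>"
        using d1 d2 by (intro exI[of _ "min 1 (min d1 d2)"]) auto
    qed
  qed
  then show ?thesis by (simp add: continuous_at_imp_continuous_on)
qed

section \<open>Horizontal curves for an alternating form\<close>

text \<open>The vectors in \<open>nonzero\<close>, normalised to the value 1, span the plane in
  which the correcting loops enclose area.\<close>

locale symplectic_form = bounded_bilinear \<omega>
  for \<omega> :: "'a::real_normed_vector \<Rightarrow> 'a \<Rightarrow> real" +
  assumes self [simp]: "\<omega> x x = 0"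
    and nonzero: "\<exists>e1 e2. \<omega> e1 e2 = 1"
begin

lemma swap: "\<omega> y x = - \<omega> x y"
proof -
  have "\<omega> (x + y) (x + y) = \<omega> x x + \<omega> x y + (\<omega> y x + \<omega> y y)"
    by (simp only: add_left add_right)
  then show ?thesis by simp
qed

section \<open>Necessity of the area condition\<close>

lemma horizontal_vanishes_at_diagonal:
  assumes "compact K" and cont: "continuous_on UNIV f'"
    and f: "\<And>s. (f has_vector_derivative f' s) (at s)"
    and k: "\<And>s. (k has_vector_derivative \<omega> (f' s) (f s)) (at s)"
  shows "vanishes_at_diagonal K (\<lambda>a b. \<bar>k b - k a - \<omega> (f b) (f a)\<bar> / \<bar>b - a\<bar>\<^sup>2)"
  unfolding vanishes_at_diagonal_def
proof (intro allI impI)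
  fix \<epsilon> :: real assume \<epsilon>: "\<epsilon> > 0"
  obtain R where R: "\<And>s. s \<in> K \<Longrightarrow> \<bar>s\<bar> \<le> R"
    using compact_imp_bounded[OF \<open>compact K\<close>] by (auto simp: bounded_iff)
  \<comment> \<open>Segments between points of \<open>K\<close> may leave \<open>K\<close>, so the
    bound and the uniform continuity of \<open>f'\<close> are taken on an interval containing
    \<open>K\<close>.\<close>
  define J where "J = {- R..R}"
  have J: "compact J" "continuous_on J f'"
    using cont by (auto simp: J_def intro: continuous_on_subset)
  obtain M where M: "M > 0" "\<And>s. s \<in> J \<Longrightarrow> norm (f' s) \<le> M"
    using compact_imp_bounded[OF compact_continuous_image[OF J(2,1)]] by (auto simp: bounded_pos)
  obtain B where B: "B > 0" "\<And>x y. norm (\<omega> x y) \<le> norm x * norm y * B"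
    using pos_bounded by blast
  \<comment> \<open>The final bound is \<open>M * e * B\<close> times the squared length; this
    choice turns the factor into \<open>\<epsilon> / 2\<close>, which leaves room for the strict
    inequality.\<close>
  define e where "e = \<epsilon> / (2 * M * B)"
  have e: "e > 0" using \<epsilon> M B by (simp add: e_def)
  obtain d where d: "d > 0"
    "\<And>s r. s \<in> J \<Longrightarrow> r \<in> J \<Longrightarrow> dist r s < d \<Longrightarrow> dist (f' r) (f' s) < e"
    using compact_uniformly_continuous[OF J(2,1)] e unfolding uniformly_continuous_on_def by metis
  show "\<exists>\<delta>>0. \<forall>a\<in>K. \<forall>b\<in>K. 0 < \<bar>b - a\<bar> \<and> \<bar>b - a\<bar> < \<delta> \<longrightarrow>
      \<bar>\<bar>k b - k a - \<omega> (f b) (f a)\<bar> / \<bar>b - a\<bar>\<^sup>2\<bar> < \<epsilon>"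
  proof (intro exI[of _ d] conjI ballI impI)
    fix a b assume ab: "a \<in> K" "b \<in> K" "0 < \<bar>b - a\<bar> \<and> \<bar>b - a\<bar> < d"
    have seg: "s \<in> J" if "s \<in> closed_segment a b" for s
      using that R[OF ab(1)] R[OF ab(2)] by (auto simp: J_def closed_segment_eq_real_ivl split: if_splits)
    have close: "norm (f' y - f' s) \<le> e" if "y \<in> closed_segment a b" "s \<in> closed_segment a b" for y s
    proof -
      have "dist y s < d"
        using that ab(3) by (auto simp: closed_segment_eq_real_ivl dist_real_def split: if_splits)
      from d(2)[OF seg[OF that(2)] seg[OF that(1)] this] show ?thesis by (simp add: dist_norm)
    qed
    \<comment> \<open>Since \<open>\<omega> (f a) (f a)\<close> vanishes,
      \<open>\<phi> b - \<phi> a\<close> is exactly the numerator to be estimated.\<close>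
    define \<phi> where "\<phi> s = k s - \<omega> (f s) (f a)" for s
    define \<phi>' where "\<phi>' s = \<omega> (f' s) (f s - f a)" for s
    have \<phi>: "(\<phi> has_vector_derivative \<phi>' s) (at s within X)" for s X
    proof -
      have "((\<lambda>s. \<omega> (f s) (f a)) has_vector_derivative \<omega> (f s) 0 + \<omega> (f' s) (f a)) (at s)"
        by (intro has_vector_derivative f has_vector_derivative_const)
      from has_vector_derivative_diff[OF k this] show ?thesis
        unfolding \<phi>_def[abs_def] \<phi>'_def
        by (simp add: zero_right diff_right has_vector_derivative_at_within)
    qed
    have \<phi>'_le: "norm (\<phi>' s) \<le> M * (\<bar>b - a\<bar> * e) * B" if s: "s \<in> closed_segment a b" for s
    proof -
      have "norm (f s - f a - (s - a) *\<^sub>R f' s) \<le> norm (s - a) * e"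
        by (rule vector_differentiable_bound_linearization[where S = "closed_segment a b"])
          (use s close has_vector_derivative_at_within[OF f] in \<open>simp_all add: subset_closed_segment\<close>)
      also have "\<dots> \<le> \<bar>b - a\<bar> * e"
        using s e by (intro mult_right_mono) (auto simp: closed_segment_eq_real_ivl split: if_splits)
      finally have 1: "norm (f s - f a - (s - a) *\<^sub>R f' s) \<le> \<bar>b - a\<bar> * e" .
      \<comment> \<open>Subtracting a multiple of \<open>f' s\<close> is free because
        \<open>\<omega>\<close> is alternating, and it turns the increment of \<open>f\<close> into
        a first-order Taylor remainder.\<close>
      have "\<phi>' s = \<omega> (f' s) (f s - f a - (s - a) *\<^sub>R f' s)"
        by (simp add: \<phi>'_def diff_right scaleR_right)
      also have "norm \<dots> \<le> norm (f' s) * norm (f s - f a - (s - a) *\<^sub>R f' s) * B" by (rule B)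
      also have "\<dots> \<le> M * (\<bar>b - a\<bar> * e) * B"
        using M(2)[OF seg[OF s]] 1 B(1) M(1) e by (intro mult_right_mono mult_mono) auto
      finally show ?thesis .
    qed
    have "norm (\<phi> b - \<phi> a) \<le> (M * (\<bar>b - a\<bar> * e) * B) * norm (b - a)"
    proof (rule differentiable_bound[where S = "closed_segment a b" and f = \<phi> and f' = "\<lambda>s h. h *\<^sub>R \<phi>' s"])
      fix s assume "s \<in> closed_segment a b"
      show "(\<phi> has_derivative (\<lambda>h. h *\<^sub>R \<phi>' s)) (at s within closed_segment a b)"
        using \<phi> by (simp add: has_vector_derivative_def)
      show "onorm (\<lambda>h. h *\<^sub>R \<phi>' s) \<le> M * (\<bar>b - a\<bar> * e) * B"
        proof (rule onorm_le)
        show "norm (h *\<^sub>R \<phi>' s) \<le> M * (\<bar>b - a\<bar> * e) * B * norm h" for h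
          using mult_right_mono[OF \<phi>'_le[OF \<open>s \<in> _\<close>] norm_ge_zero[of h]]
          by (simp add: abs_mult mult_ac)
      qed
    qed simp_all
    also have "\<dots> = \<epsilon> / 2 * \<bar>b - a\<bar>\<^sup>2"
      using M B by (simp add: e_def power2_eq_square)
    also have "\<dots> < \<epsilon> * \<bar>b - a\<bar>\<^sup>2" using ab \<epsilon> by simp
    finally have "\<bar>k b - k a - \<omega> (f b) (f a)\<bar> < \<epsilon> * \<bar>b - a\<bar>\<^sup>2" by (simp add: \<phi>_def)
    then show "\<bar>\<bar>k b - k a - \<omega> (f b) (f a)\<bar> / \<bar>b - a\<bar>\<^sup>2\<bar> < \<epsilon>"
      using ab by (simp add: pos_divide_less_eq)
  qed (rule d)
qed

end

section \<open>A horizontal curve across one gap with prescribed end data\<close>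

lemma has_vector_derivative_scaleR_const:
  assumes "(f has_real_derivative f') F"
  shows "((\<lambda>x. f x *\<^sub>R c) has_vector_derivative f' *\<^sub>R c) F"
  using bounded_linear.has_vector_derivative[OF bounded_linear_scaleR_left] assms
  by (auto simp: has_real_derivative_iff_has_vector_derivative)

text \<open>Choose \<open>\<sigma>\<close> so that the quadratic term has the sign of
  \<open>\<delta>\<close>, then the sign of \<open>\<eta>\<close> so that the linear term has it
  too. What remains is \<open>c * x\<^sup>2 + l * x = \<bar>\<delta>\<bar>\<close> with
  \<open>l \<ge> 0\<close>; at \<open>m\<close> the quadratic term alone reaches the right-hand
  side, so the bound on \<open>\<eta>\<close> is independent of \<open>b\<close>. The linear
  coefficient may depend on \<open>\<sigma>\<close> because reversing the loop changes it.\<close>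

lemma signed_quadratic_solution:
  fixes b :: "real \<Rightarrow> real"
  assumes c: "c > 0"
  obtains \<sigma> \<eta> where "\<sigma> = 1 \<or> \<sigma> = - 1" "\<eta> * b \<sigma> - \<sigma> * c * \<eta>\<^sup>2 = \<delta>" "\<bar>\<eta>\<bar> \<le> sqrt (\<bar>\<delta>\<bar> / c)"
proof -
  define \<sigma> :: real where "\<sigma> = (if \<delta> \<ge> 0 then - 1 else 1)"
  define l where "l = \<bar>b \<sigma>\<bar>"
  define m where "m = sqrt (\<bar>\<delta>\<bar> / c)"
  have "m \<ge> 0" "c * m\<^sup>2 = \<bar>\<delta>\<bar>" using c by (simp_all add: m_def)
  then have "0 \<le> \<bar>\<delta>\<bar>" "\<bar>\<delta>\<bar> \<le> c * m\<^sup>2 + l * m" by (simp_all add: l_def)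
  then obtain x where x: "0 \<le> x" "x \<le> m" "c * x\<^sup>2 + l * x = \<bar>\<delta>\<bar>"
    using IVT'[of "\<lambda>x. c * x\<^sup>2 + l * x" 0 "\<bar>\<delta>\<bar>" m] \<open>m \<ge> 0\<close>
    by (force intro!: continuous_intros)
  define \<eta> where "\<eta> = (if (\<delta> \<ge> 0) = (b \<sigma> \<ge> 0) then x else - x)"
  show thesis
  proof
    show "\<sigma> = 1 \<or> \<sigma> = - 1" by (simp add: \<sigma>_def)
    show "\<eta> * b \<sigma> - \<sigma> * c * \<eta>\<^sup>2 = \<delta>"
      using x(3) by (cases "\<delta> \<ge> 0"; cases "b \<sigma> \<ge> 0") (simp_all add: \<eta>_def \<sigma>_def l_def algebra_simps)
    show "\<bar>\<eta>\<bar> \<le> sqrt (\<bar>\<delta>\<bar> / c)" using x(1,2) by (simp add: \<eta>_def m_def)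
  qed
qed

context symplectic_form
begin

text \<open>The gap problem after rescaling to the unit interval: \<open>D\<close> and
  \<open>W\<close> measure how far the end data are from those of the straight motion
  \<open>t *\<^sub>R v\<close>. The constant \<open>C\<close> precedes all data, so one estimate
  serves every gap. The square root appears because the loop changes the height quadratically in its
  size.\<close>

lemma horizontal_unit_curve:
  obtains C where "C > 0"
    "\<And>v D W \<alpha> \<rho>. \<rho> = norm D + norm W \<Longrightarrow>
      \<exists>g g' k. g 0 = 0 \<and> g 1 = v + D \<and> g' 0 = v \<and> g' 1 = v + W \<and> k 0 = 0 \<and> k 1 = \<alpha> \<and>
      continuous_on UNIV g' \<and> (\<forall>t. (g has_vector_derivative g' t) (at t)) \<and>
      (\<forall>t\<in>{0..1}. (k has_vector_derivative \<omega> (g' t) (g t)) (at t within {0..1})) \<and>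
      (\<forall>t\<in>{0..1}. norm (g' t - v) \<le> C * (\<rho> + sqrt (\<bar>\<alpha>\<bar> + \<rho> * (norm v + \<rho>))))"
proof -
  obtain e1 e2 where e12: "\<omega> e1 e2 = 1" using nonzero by blast
  obtain B where B: "B > 0" "\<And>x y. norm (\<omega> x y) \<le> norm x * norm y * B"
    using pos_bounded by blast
  \<comment> \<open>\<open>m\<close> absorbs the bound \<open>6 * B\<close> on the height of the
    interpolant, \<open>E\<close> bounds the speed of the loop, and \<open>C\<close> adds the factor
    2 from the interpolant to the factor from \<open>\<eta>\<close> times the loop.\<close>
  define m where "m = max 1 (6 * B)"
  define E where "E = 8 * (norm e1 + norm e2)"
  define C where "C = 2 + E * sqrt (630 * m)"
  have "m \<ge> 1" "m \<ge> 6 * B" "E \<ge> 0" by (simp_all add: m_def E_def)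
  show thesis
  proof
    show "C > 0" using \<open>E \<ge> 0\<close> \<open>m \<ge> 1\<close> by (simp add: C_def add_pos_nonneg)
    fix v D W :: 'a and \<alpha> \<rho> :: real
    assume \<rho>_def: "\<rho> = norm D + norm W"
    then have \<rho>: "\<rho> \<ge> 0" by simp
    \<comment> \<open>Cubic Hermite weights: the first rises from 0 to 1 with zero slope at both
      ends; the second vanishes at both ends, with slope 0 at 0 and slope 1 at 1.\<close>
    define r where "r t = (3 * t^2 - 2 * t^3) *\<^sub>R D + (t^3 - t^2) *\<^sub>R W" for t :: real
    define r' where "r' t = (6 * t - 6 * t^2) *\<^sub>R D + (3 * t^2 - 2 * t) *\<^sub>R W" for t :: real
    \<comment> \<open>The loop has components \<open>t\<^sup>2 (1 - t)\<^sup>2\<close> and \<open>\<sigma> t\<^sup>3 (1 - t)\<^sup>2\<close>, so it is closed with vanishing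
      velocity at both ends; the constant \<open>1 / 630\<close> below is the integral of \<open>t\<^sup>4 (1 - t)\<^sup>4\<close>.\<close>
    define p where "p \<sigma> t = (t^2 - 2 * t^3 + t^4) *\<^sub>R e1 + (\<sigma> * (t^3 - 2 * t^4 + t^5)) *\<^sub>R e2" for \<sigma> t :: real
    define p' where "p' \<sigma> t = (2 * t - 6 * t^2 + 4 * t^3) *\<^sub>R e1 + (\<sigma> * (3 * t^2 - 8 * t^3 + 5 * t^4)) *\<^sub>R e2"
      for \<sigma> t :: real
    define g0 where "g0 t = t *\<^sub>R v + r t" for t
    define g0' where "g0' t = v + r' t" for t
    have g0: "(g0 has_vector_derivative g0' t) (at t within X)" for t X
    proof -
      have v: "((\<lambda>t. t *\<^sub>R v) has_vector_derivative 1 *\<^sub>R v) (at t within X)"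
        by (intro has_vector_derivative_scaleR_const) (rule DERIV_ident)
      have D: "((\<lambda>t. (3 * t^2 - 2 * t^3) *\<^sub>R D) has_vector_derivative (6 * t - 6 * t^2) *\<^sub>R D) (at t within X)"
        by (intro has_vector_derivative_scaleR_const) (auto intro!: derivative_eq_intros)
      have W: "((\<lambda>t. (t^3 - t^2) *\<^sub>R W) has_vector_derivative (3 * t^2 - 2 * t) *\<^sub>R W) (at t within X)"
        by (intro has_vector_derivative_scaleR_const) (auto intro!: derivative_eq_intros)
      show ?thesis
        using has_vector_derivative_add[OF v has_vector_derivative_add[OF D W]]
        unfolding g0_def[abs_def] g0'_def r_def r'_def by simp
    qed
    have p: "(p \<sigma> has_vector_derivative p' \<sigma> t) (at t within X)" for \<sigma> t X
    proof -
      have "((\<lambda>t. (t^2 - 2 * t^3 + t^4) *\<^sub>R e1) has_vector_derivative (2 * t - 6 * t^2 + 4 * t^3) *\<^sub>R e1) (at t within X)"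
        by (intro has_vector_derivative_scaleR_const) (auto intro!: derivative_eq_intros simp: field_simps)
      moreover have "((\<lambda>t. (\<sigma> * (t^3 - 2 * t^4 + t^5)) *\<^sub>R e2) has_vector_derivative
          (\<sigma> * (3 * t^2 - 8 * t^3 + 5 * t^4)) *\<^sub>R e2) (at t within X)"
        by (intro has_vector_derivative_scaleR_const) (auto intro!: derivative_eq_intros simp: field_simps)
      ultimately show ?thesis
        unfolding p_def[abs_def] p'_def by (rule has_vector_derivative_add)
    qed
    have cont: "continuous_on X g0" "continuous_on X g0'" "continuous_on X (p \<sigma>)" "continuous_on X (p' \<sigma>)" for X \<sigma>
      unfolding g0_def[abs_def] g0'_def[abs_def] r_def r'_def p_def[abs_def] p'_def[abs_def]
      by (intro continuous_intros)+
    have cont\<omega>: "continuous_on X (\<lambda>t. \<omega> (x t) (y t))" if "continuous_on X x" "continuous_on X y" for X :: "real set" and x y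
      using continuous_on[OF that] .
    have powers: "0 \<le> t^5" "t^5 \<le> t^4" "t^4 \<le> t^3" "t^3 \<le> t^2" "t^2 \<le> t" "0 \<le> t" "t \<le> 1" if "t \<in> {0..1}" for t :: real
      using that power_decreasing[of 4 5 t] power_decreasing[of 3 4 t] power_decreasing[of 2 3 t] power_decreasing[of 1 2 t]
      by auto
    have r_le: "norm (r t) \<le> 3 * \<rho>" and r'_le: "norm (r' t) \<le> 2 * \<rho>" if t: "t \<in> {0..1}" for t
    proof -
      have combine: "norm (x *\<^sub>R D + y *\<^sub>R W) \<le> z * \<rho>" if "\<bar>x\<bar> \<le> z" "\<bar>y\<bar> \<le> z" for x y z :: real
        using norm_triangle_mono[of "x *\<^sub>R D" "z * norm D" "y *\<^sub>R W" "z * norm W"] that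
        by (simp add: mult_right_mono \<rho>_def distrib_left)
      show "norm (r t) \<le> 3 * \<rho>" unfolding r_def
        by (rule combine; use powers[OF t] in linarith)
      have "6 * t - 6 * t^2 \<le> 2"
        using zero_le_power2[of "t - 1/2"] by (simp add: power2_diff power2_eq_square field_simps)
      then show "norm (r' t) \<le> 2 * \<rho>" unfolding r'_def
        by (intro combine; use powers[OF t] in linarith)
    qed
    have p'_le: "norm (p' \<sigma> t) \<le> E" if t: "t \<in> {0..1}" and \<sigma>: "\<sigma> = 1 \<or> \<sigma> = - 1" for \<sigma> t
    proof -
      have "\<bar>2 * t - 6 * t^2 + 4 * t^3\<bar> \<le> 8" using powers[OF t] by linarith
      moreover have "\<bar>\<sigma> * (3 * t^2 - 8 * t^3 + 5 * t^4)\<bar> \<le> 8"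
      proof -
        have "\<bar>3 * t^2 - 8 * t^3 + 5 * t^4\<bar> \<le> 8" using powers[OF t] by linarith
        then show ?thesis using \<sigma> by (auto simp: abs_mult)
      qed
      ultimately show ?thesis
        unfolding p'_def E_def distrib_left
        by (intro norm_triangle_mono) (simp_all add: mult_right_mono)
    qed
    \<comment> \<open>\<open>i0\<close>, \<open>i1\<close> and
      \<open>\<omega> (p' \<sigma> t) (p \<sigma> t)\<close> are the coefficients of 1,
      \<open>\<eta>\<close> and \<open>\<eta>\<^sup>2\<close> in the height derivative of
      \<open>g0 + \<eta> p\<close>. The third has the explicit antiderivative \<open>k2\<close> up
      to the factor \<open>- \<sigma>\<close>, and \<open>k2 1 = 1 / 630\<close>.\<close>
    define i0 where "i0 t = \<omega> (g0' t) (g0 t)" for t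
    define i1 where "i1 \<sigma> t = \<omega> (g0' t) (p \<sigma> t) + \<omega> (p' \<sigma> t) (g0 t)" for \<sigma> t
    define k0 where "k0 t = integral {0..t} i0" for t
    define k1 where "k1 \<sigma> t = integral {0..t} (i1 \<sigma>)" for \<sigma> t
    define k2 where "k2 t = t^5 / 5 - 4 * t^6 / 6 + 6 * t^7 / 7 - 4 * t^8 / 8 + t^9 / 9" for t :: real
    have k0: "(k0 has_vector_derivative i0 t) (at t within {0..1})" if "t \<in> {0..1}" for t
      unfolding k0_def[abs_def] using that
      by (intro integral_has_vector_derivative) (auto simp: i0_def[abs_def] intro!: cont\<omega> cont)
    have k1: "(k1 \<sigma> has_vector_derivative i1 \<sigma> t) (at t within {0..1})" if "t \<in> {0..1}" for \<sigma> t
      unfolding k1_def[abs_def] using that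
      by (intro integral_has_vector_derivative) (auto simp: i1_def[abs_def] intro!: continuous_on_add cont\<omega> cont)
    have square: "(t^2 - 2 * t^3 + t^4)^2 = t^4 - 4 * t^5 + 6 * t^6 - 4 * t^7 + t^8" for t :: real
      by algebra
    have k2: "(k2 has_vector_derivative (t^2 - 2 * t^3 + t^4)^2) (at t within X)" for t X
      unfolding k2_def[abs_def] square has_real_derivative_iff_has_vector_derivative[symmetric]
      by (auto intro!: derivative_eq_intros)
    \<comment> \<open>Writing \<open>q\<close> for \<open>t^2 - 2 * t^3 + t^4\<close>, the second
      loop component is \<open>t * q\<close> up to \<open>\<sigma>\<close>, and
      \<open>q' * (t * q) - (t * q)' * q = - q^2\<close>. The integrand thus has constant sign, and
      the loop encloses nonzero area.\<close>
    have area: "(2 * t - 6 * t^2 + 4 * t^3) * (t^3 - 2 * t^4 + t^5) - (3 * t^2 - 8 * t^3 + 5 * t^4) * (t^2 - 2 * t^3 + t^4)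
        = - ((t^2 - 2 * t^3 + t^4)^2)" for t :: real
      by algebra
    have p'p: "\<omega> (p' \<sigma> t) (p \<sigma> t) = - \<sigma> * (t^2 - 2 * t^3 + t^4)^2" for \<sigma> t
    proof -
      have bilin: "\<omega> (a *\<^sub>R e1 + (\<sigma> * b) *\<^sub>R e2) (c *\<^sub>R e1 + (\<sigma> * d) *\<^sub>R e2) = \<sigma> * (a * d - b * c)" for a b c d
        by (simp add: add_left add_right scaleR_left scaleR_right e12 swap[of e2 e1] algebra_simps)
      show ?thesis unfolding p_def p'_def bilin area by simp
    qed
    have k0_le: "\<bar>k0 1\<bar> \<le> 6 * B * (\<rho> * (norm v + \<rho>))"
    proof -
      have "norm (k0 1) \<le> 6 * B * (\<rho> * (norm v + \<rho>)) * (1 - 0)"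
        unfolding k0_def
      proof (rule integral_bound)
        show "continuous_on {0..1} i0" by (auto simp: i0_def[abs_def] intro!: cont\<omega> cont)
        fix t :: real assume t: "t \<in> {0..1}"
        \<comment> \<open>The term \<open>t * \<omega> v v\<close> drops out, so every remaining
          term contains \<open>r\<close> or \<open>r'\<close> and hence a factor
          \<open>\<rho>\<close>.\<close>
        have "i0 t = \<omega> v (r t) + t * \<omega> (r' t) v + \<omega> (r' t) (r t)"
          by (simp add: i0_def g0_def g0'_def add_left add_right scaleR_right)
        also have "norm \<dots> \<le> norm v * (3 * \<rho>) * B + (2 * \<rho>) * norm v * B + (2 * \<rho>) * (3 * \<rho>) * B"
        proof (intro norm_triangle_mono)
          show "norm (\<omega> v (r t)) \<le> norm v * (3 * \<rho>) * B"
            using B r_le[OF t] by (intro order_trans[OF B(2)] mult_right_mono mult_left_mono) auto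
          have "norm (\<omega> (r' t) v) \<le> (2 * \<rho>) * norm v * B"
            using B r'_le[OF t] by (intro order_trans[OF B(2)] mult_right_mono) auto
          then show "norm (t * \<omega> (r' t) v) \<le> (2 * \<rho>) * norm v * B"
            using t mult_mono[of t 1 "\<bar>\<omega> (r' t) v\<bar>" "(2 * \<rho>) * norm v * B"] by (simp add: abs_mult)
          show "norm (\<omega> (r' t) (r t)) \<le> (2 * \<rho>) * (3 * \<rho>) * B"
            using B r_le[OF t] r'_le[OF t] \<rho> by (intro order_trans[OF B(2)] mult_right_mono mult_mono) auto
        qed
        also have "\<dots> \<le> 6 * B * (\<rho> * (norm v + \<rho>))"
          using B \<rho> by (simp add: algebra_simps)
        finally show "norm (i0 t) \<le> 6 * B * (\<rho> * (norm v + \<rho>))" .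
      qed auto
      then show ?thesis by simp
    qed
    \<comment> \<open>The equation says that the corrected curve ends at height
      \<open>\<alpha>\<close>. The bound on \<open>\<eta>\<close> involves only the height defect of
      the interpolant, not the mixed term \<open>k1\<close>.\<close>
    obtain \<sigma> \<eta> where \<sigma>: "\<sigma> = 1 \<or> \<sigma> = - 1" and eq: "\<eta> * k1 \<sigma> 1 - \<sigma> * (1 / 630) * \<eta>\<^sup>2 = \<alpha> - k0 1"
      and \<eta>: "\<bar>\<eta>\<bar> \<le> sqrt (\<bar>\<alpha> - k0 1\<bar> / (1 / 630))"
      using signed_quadratic_solution[where c = "1 / 630" and b = "\<lambda>\<sigma>. k1 \<sigma> 1" and \<delta> = "\<alpha> - k0 1"] by auto
    define g where "g t = g0 t + \<eta> *\<^sub>R p \<sigma> t" for t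
    define g' where "g' t = g0' t + \<eta> *\<^sub>R p' \<sigma> t" for t
    define k where "k t = k0 t + \<eta> * k1 \<sigma> t + (- \<sigma> * \<eta>\<^sup>2) * k2 t" for t
    have "(g has_vector_derivative g' t) (at t)" for t
      unfolding g_def[abs_def] g'_def
      by (intro has_vector_derivative_add g0 bounded_linear.has_vector_derivative[OF bounded_linear_scaleR_right] p)
    moreover have "(k has_vector_derivative \<omega> (g' t) (g t)) (at t within {0..1})" if t: "t \<in> {0..1}" for t
    proof -
      have "\<omega> (g' t) (g t) = i0 t + \<eta> * i1 \<sigma> t + \<eta>\<^sup>2 * \<omega> (p' \<sigma> t) (p \<sigma> t)"
        by (simp add: g_def g'_def i0_def i1_def add_left add_right scaleR_left scaleR_right power2_eq_square algebra_simps)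
      then have "\<omega> (g' t) (g t) = i0 t + \<eta> * i1 \<sigma> t + (- \<sigma> * \<eta>\<^sup>2) * (t^2 - 2 * t^3 + t^4)^2"
        by (simp add: p'p)
      then show ?thesis
        unfolding k_def[abs_def]
        by (simp only:) (intro has_vector_derivative_add has_vector_derivative_mult_right k0 k1 k2 t)
    qed
    moreover have "continuous_on UNIV g'"
      unfolding g'_def[abs_def] by (intro continuous_intros cont)
    moreover have "norm (g' t - v) \<le> C * (\<rho> + sqrt (\<bar>\<alpha>\<bar> + \<rho> * (norm v + \<rho>)))" if t: "t \<in> {0..1}" for t
    proof -
      define S where "S = \<bar>\<alpha>\<bar> + \<rho> * (norm v + \<rho>)"
      have "\<rho> * (norm v + \<rho>) \<ge> 0" using \<rho> by simp
      then have S: "S \<ge> 0" "\<bar>\<alpha> - k0 1\<bar> \<le> m * S"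
        using k0_le mult_right_mono[OF \<open>m \<ge> 6 * B\<close>, of "\<rho> * (norm v + \<rho>)"] mult_right_mono[OF \<open>m \<ge> 1\<close>, of "\<bar>\<alpha>\<bar>"]
        by (simp_all add: S_def distrib_left)
      have "\<bar>\<eta>\<bar> \<le> sqrt (630 * m * S)"
        using S by (intro order_trans[OF \<eta>] real_sqrt_le_mono) simp
      then have \<eta>': "\<bar>\<eta>\<bar> \<le> sqrt (630 * m) * sqrt S" by (simp add: real_sqrt_mult)
      have "g' t - v = r' t + \<eta> *\<^sub>R p' \<sigma> t" by (simp add: g'_def g0'_def)
      also have "norm \<dots> \<le> 2 * \<rho> + (sqrt (630 * m) * sqrt S) * E"
        using r'_le[OF t] p'_le[OF t \<sigma>] \<eta>' S \<open>m \<ge> 1\<close>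
        by (intro norm_triangle_mono) (simp_all add: mult_mono)
      also have "\<dots> \<le> C * (\<rho> + sqrt S)"
        using \<rho> S \<open>E \<ge> 0\<close> \<open>m \<ge> 1\<close> by (simp add: C_def algebra_simps)
      finally show ?thesis by (simp add: S_def)
    qed
    moreover have "g 0 = 0" "g 1 = v + D" "g' 0 = v" "g' 1 = v + W"
      by (simp_all add: g_def g'_def g0_def g0'_def r_def r'_def p_def p'_def)
    moreover have "k 0 = 0" by (simp add: k_def k0_def k1_def k2_def)
    moreover have "k 1 = \<alpha>" using eq by (simp add: k_def k2_def algebra_simps)
    ultimately show "\<exists>g g' k. g 0 = 0 \<and> g 1 = v + D \<and> g' 0 = v \<and> g' 1 = v + W \<and> k 0 = 0 \<and> k 1 = \<alpha> \<and>
      continuous_on UNIV g' \<and> (\<forall>t. (g has_vector_derivative g' t) (at t)) \<and>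
      (\<forall>t\<in>{0..1}. (k has_vector_derivative \<omega> (g' t) (g t)) (at t within {0..1})) \<and>
      (\<forall>t\<in>{0..1}. norm (g' t - v) \<le> C * (\<rho> + sqrt (\<bar>\<alpha>\<bar> + \<rho> * (norm v + \<rho>))))"
      by blast
  qed
qed

text \<open>Reduction to the unit interval by a dilation of ratio \<open>b - a\<close> followed by a
  group translation, both of which preserve horizontality. Velocities are unchanged while heights
  scale by the square of the ratio; this is why \<open>\<alpha>\<close> is divided by
  \<open>(b - a)\<^sup>2\<close>.\<close>

lemma horizontal_curve_between:
  obtains C where "C > 0"
    "\<And>a b p q v w x y \<rho> \<alpha>. a < b \<Longrightarrow> \<rho> = norm ((q - p) /\<^sub>R (b - a) - v) + norm (w - v) \<Longrightarrow>
      \<alpha> = (y - x - \<omega> q p) / (b - a)\<^sup>2 \<Longrightarrow>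
      \<exists>f f' k. f a = p \<and> f b = q \<and> f' a = v \<and> f' b = w \<and> k a = x \<and> k b = y \<and>
        continuous_on UNIV f' \<and> (\<forall>s. (f has_vector_derivative f' s) (at s)) \<and>
        (\<forall>s\<in>{a..b}. (k has_vector_derivative \<omega> (f' s) (f s)) (at s within {a..b})) \<and>
        (\<forall>s\<in>{a..b}. norm (f' s - v) \<le> C * (\<rho> + sqrt (\<bar>\<alpha>\<bar> + \<rho> * (norm v + \<rho>))))"
proof -
  obtain C where "C > 0" and unit:
    "\<And>v D W \<alpha> \<rho>. \<rho> = norm D + norm W \<Longrightarrow>
      \<exists>g g' k. g 0 = 0 \<and> g 1 = v + D \<and> g' 0 = v \<and> g' 1 = v + W \<and> k 0 = 0 \<and> k 1 = \<alpha> \<and>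
      continuous_on UNIV g' \<and> (\<forall>t. (g has_vector_derivative g' t) (at t)) \<and>
      (\<forall>t\<in>{0..1}. (k has_vector_derivative \<omega> (g' t) (g t)) (at t within {0..1})) \<and>
      (\<forall>t\<in>{0..1}. norm (g' t - v) \<le> C * (\<rho> + sqrt (\<bar>\<alpha>\<bar> + \<rho> * (norm v + \<rho>))))"
    by (rule horizontal_unit_curve) (rule that)
  show thesis
  proof
    show "C > 0" by fact
    fix a b x y \<rho> \<alpha> :: real and p q v w :: 'a
    assume "a < b" and \<rho>: "\<rho> = norm ((q - p) /\<^sub>R (b - a) - v) + norm (w - v)"
      and \<alpha>: "\<alpha> = (y - x - \<omega> q p) / (b - a)\<^sup>2"
    define u where "u = b - a"
    have u: "u > 0" using \<open>a < b\<close> by (simp add: u_def)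
    define D where "D = (q - p) /\<^sub>R u - v"
    define W where "W = w - v"
    have \<alpha>_u: "\<alpha> = (y - x - \<omega> q p) / u\<^sup>2" and \<rho>_DW: "\<rho> = norm D + norm W"
      by (simp_all add: \<alpha> \<rho> D_def W_def u_def)
    obtain g g' \<kappa> where g: "g 0 = 0" "g 1 = v + D" "g' 0 = v" "g' 1 = v + W" "\<kappa> 0 = 0" "\<kappa> 1 = \<alpha>"
      "continuous_on UNIV g'" "\<And>t. (g has_vector_derivative g' t) (at t)"
      "\<And>t. t \<in> {0..1} \<Longrightarrow> (\<kappa> has_vector_derivative \<omega> (g' t) (g t)) (at t within {0..1})"
      "\<And>t. t \<in> {0..1} \<Longrightarrow> norm (g' t - v) \<le> C * (\<rho> + sqrt (\<bar>\<alpha>\<bar> + \<rho> * (norm v + \<rho>)))"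
      using unit[OF \<rho>_DW, of v \<alpha>] by blast
    define \<tau> where "\<tau> s = (s - a) / u" for s
    have \<tau>: "(\<tau> has_vector_derivative 1 / u) (at s within X)" for s X
      unfolding \<tau>_def[abs_def] has_real_derivative_iff_has_vector_derivative[symmetric]
      using u by (auto intro!: derivative_eq_intros)
    have \<tau>01: "\<tau> s \<in> {0..1}" if "s \<in> {a..b}" for s
      using that u by (simp add: \<tau>_def u_def)
    have \<tau>_ends: "\<tau> a = 0" "\<tau> b = 1" using u by (simp_all add: \<tau>_def u_def)
    define f where "f s = p + u *\<^sub>R g (\<tau> s)" for s
    define f' where "f' s = g' (\<tau> s)" for s
    \<comment> \<open>The term \<open>\<omega> (f s - p) p\<close> is the height contributed by the
      translation: its derivative \<open>\<omega> (f' s) p\<close> supplies the part of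
      \<open>\<omega> (f' s) (f s)\<close> that the dilated unit curve lacks.\<close>
    define k where "k s = x + \<omega> (f s - p) p + u\<^sup>2 * \<kappa> (\<tau> s)" for s
    have f: "(f has_vector_derivative f' s) (at s within X)" for s X
    proof -
      have "(g \<circ> \<tau> has_vector_derivative (1 / u) *\<^sub>R g' (\<tau> s)) (at s within X)"
        using vector_diff_chain_within[OF \<tau> has_vector_derivative_at_within[OF g(8)]] .
      then have "((\<lambda>s. p + u *\<^sub>R (g \<circ> \<tau>) s) has_vector_derivative 0 + u *\<^sub>R ((1 / u) *\<^sub>R g' (\<tau> s))) (at s within X)"
        by (intro has_vector_derivative_add has_vector_derivative_const
            bounded_linear.has_vector_derivative[OF bounded_linear_scaleR_right])
      then show ?thesis using u by (simp add: f_def[abs_def] f'_def)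
    qed
    have "(k has_vector_derivative \<omega> (f' s) (f s)) (at s within {a..b})" if s: "s \<in> {a..b}" for s
    proof -
      have "(\<kappa> \<circ> \<tau> has_vector_derivative (1 / u) *\<^sub>R \<omega> (g' (\<tau> s)) (g (\<tau> s))) (at s within {a..b})"
        using \<tau>01 s by (intro vector_diff_chain_within \<tau> has_vector_derivative_within_subset[OF g(9)]) auto
      then have "((\<lambda>s. u\<^sup>2 * (\<kappa> \<circ> \<tau>) s) has_vector_derivative u\<^sup>2 * ((1 / u) *\<^sub>R \<omega> (g' (\<tau> s)) (g (\<tau> s))))
          (at s within {a..b})"
        by (rule has_vector_derivative_mult_right)
      moreover have "((\<lambda>s. x + \<omega> (f s - p) p) has_vector_derivative
          0 + (\<omega> (f s - p) 0 + \<omega> (f' s - 0) p)) (at s within {a..b})"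
        by (intro has_vector_derivative_add has_vector_derivative has_vector_derivative_diff
            has_vector_derivative_const f)
      ultimately have "(k has_vector_derivative 0 + (\<omega> (f s - p) 0 + \<omega> (f' s - 0) p)
          + u\<^sup>2 * ((1 / u) *\<^sub>R \<omega> (g' (\<tau> s)) (g (\<tau> s)))) (at s within {a..b})"
        unfolding k_def[abs_def] o_def by (rule has_vector_derivative_add[rotated])
      moreover have "0 + (\<omega> (f s - p) 0 + \<omega> (f' s - 0) p) + u\<^sup>2 * ((1 / u) *\<^sub>R \<omega> (g' (\<tau> s)) (g (\<tau> s)))
          = \<omega> (f' s) (f s)"
        using u by (simp add: f_def f'_def add_right scaleR_right zero_right power2_eq_square)
      ultimately show ?thesis by simp
    qed
    moreover have "continuous_on UNIV f'"
    proof -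
      have "continuous_on UNIV \<tau>" unfolding \<tau>_def[abs_def] using u by (intro continuous_intros) auto
      then show ?thesis
        unfolding f'_def[abs_def] using continuous_on_compose2[OF g(7)] by blast
    qed
    moreover have "f b = q" using u by (simp add: f_def \<tau>_ends g D_def)
    moreover from this have "k b = y" using u by (simp add: k_def \<tau>_ends g \<alpha>_u diff_left)
    moreover have "f a = p" "f' a = v" "f' b = w" "k a = x"
      by (simp_all add: f_def f'_def k_def \<tau>_ends g W_def zero_left)
    moreover have "\<forall>s\<in>{a..b}. norm (f' s - v) \<le> C * (\<rho> + sqrt (\<bar>\<alpha>\<bar> + \<rho> * (norm v + \<rho>)))"
      using g(10) \<tau>01 by (simp add: f'_def)
    ultimately show "\<exists>f f' k. f a = p \<and> f b = q \<and> f' a = v \<and> f' b = w \<and> k a = x \<and> k b = y \<and>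
        continuous_on UNIV f' \<and> (\<forall>s. (f has_vector_derivative f' s) (at s)) \<and>
        (\<forall>s\<in>{a..b}. (k has_vector_derivative \<omega> (f' s) (f s)) (at s within {a..b})) \<and>
        (\<forall>s\<in>{a..b}. norm (f' s - v) \<le> C * (\<rho> + sqrt (\<bar>\<alpha>\<bar> + \<rho> * (norm v + \<rho>))))"
      using f by blast
  qed
qed

end

section \<open>Assembling a function from its values on K and its pieces off K\<close>

text \<open>For \<open>s\<close> in a bounded gap of \<open>K\<close>, the supremum and infimum below are the endpoints of that gap.\<close>

definition patch ::
  "real set \<Rightarrow> (real \<Rightarrow> 'a) \<Rightarrow> (real \<Rightarrow> 'a) \<Rightarrow> (real \<Rightarrow> 'a) \<Rightarrow> (real \<Rightarrow> real \<Rightarrow> real \<Rightarrow> 'a) \<Rightarrow> real \<Rightarrow> 'a" where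
  "patch K X l r i s = (if s \<in> K then X s else if s < Inf K then l s else if Sup K < s then r s
     else i (Sup (K \<inter> {..s})) (Inf (K \<inter> {s..})) s)"

lemma compact_Inf_Sup:
  fixes K :: "real set"
  assumes "compact K" "K \<noteq> {}"
  shows "Inf K \<in> K" "Sup K \<in> K" "\<And>s. s \<in> K \<Longrightarrow> Inf K \<le> s \<and> s \<le> Sup K"
proof -
  have "bdd_below K" "bdd_above K" "closed K"
    using assms(1) by (auto intro: bounded_imp_bdd_below bounded_imp_bdd_above compact_imp_bounded compact_imp_closed)
  then show "Inf K \<in> K" "Sup K \<in> K" "\<And>s. s \<in> K \<Longrightarrow> Inf K \<le> s \<and> s \<le> Sup K"
    using assms(2) by (auto simp: closed_contains_Inf closed_contains_Sup cInf_lower cSup_upper)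
qed

lemma patch_left:
  assumes "compact K" "K \<noteq> {}" "X (Inf K) = l (Inf K)" "s \<le> Inf K"
  shows "patch K X l r i s = l s"
  using assms(3,4) compact_Inf_Sup(1)[OF assms(1,2)] compact_Inf_Sup(3)[OF assms(1,2), of s]
  by (cases "s = Inf K") (auto simp: patch_def)

lemma patch_right:
  assumes "compact K" "K \<noteq> {}" "X (Sup K) = r (Sup K)" "Sup K \<le> s"
  shows "patch K X l r i s = r s"
  using assms(3,4) compact_Inf_Sup(2)[OF assms(1,2)] compact_Inf_Sup(3)[OF assms(1,2), of s]
    compact_Inf_Sup(3)[OF assms(1,2), of "Sup K"]
  by (cases "s = Sup K") (auto simp: patch_def)

lemma patch_gap:
  assumes K: "compact K" "K \<noteq> {}" and ab: "a \<in> K" "b \<in> K" "{a<..<b} \<inter> K = {}"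
    and "i a b a = X a" "i a b b = X b" and s: "s \<in> {a..b}"
  shows "patch K X l r i s = i a b s"
proof (cases "s = a \<or> s = b")
  case True
  then show ?thesis using assms by (auto simp: patch_def)
next
  case False
  then have "a < s" "s < b" using s by auto
  then have "s \<notin> K" using ab(3) by auto
  moreover have "Sup (K \<inter> {..s}) = a" "Inf (K \<inter> {s..}) = b"
    using ab \<open>a < s\<close> \<open>s < b\<close> \<open>s \<notin> K\<close>
    by (auto intro!: cSup_eq_maximum cInf_eq_minimum simp: disjoint_iff) (smt (verit))+
  moreover have "\<not> s < Inf K" "\<not> Sup K < s"
    using compact_Inf_Sup(3)[OF K ab(1)] compact_Inf_Sup(3)[OF K ab(2)] \<open>a < s\<close> \<open>s < b\<close> by auto
  ultimately show ?thesis by (simp add: patch_def)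
qed

text \<open>The midpoint of the interval decides which component of the complement of
  \<open>K\<close> contains it: each point of \<open>K\<close> is at most \<open>c\<close> or at
  least \<open>d\<close>, so what holds around the midpoint holds for all of the interval.\<close>

lemma gap_cases:
  fixes K :: "real set"
  assumes K: "compact K" "K \<noteq> {}" and cd: "c < d" "{c<..<d} \<inter> K = {}"
  obtains "d \<le> Inf K" | "Sup K \<le> c"
    | a b where "a \<in> K" "b \<in> K" "a < b" "{a<..<b} \<inter> K = {}" "a \<le> c" "d \<le> b"
proof -
  define z where "z = (c + d) / 2"
  have z: "c < z" "z < d" "z \<notin> K" using cd by (auto simp: z_def disjoint_iff)
  note IS = compact_Inf_Sup[OF K]
  have out: "x \<le> c \<or> d \<le> x" if "x \<in> K" for x
  proof -
    have "x \<notin> {c<..<d}" using cd(2) that by blast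
    then show ?thesis by auto
  qed
  consider "z < Inf K" | "Sup K < z" | "Inf K \<le> z" "z \<le> Sup K" by linarith
  then show thesis
  proof cases
    case 1
    then have "d \<le> Inf K" using out[OF IS(1)] z by linarith
    then show thesis by (rule that)
  next
    case 2
    then have "Sup K \<le> c" using out[OF IS(2)] z by linarith
    then show thesis by (rule that)
  next
    case 3
    obtain a where a: "a \<in> K" "a \<in> closed_segment (Inf K) z" "open_segment a z \<inter> K = {}"
      using closed_nearest_on_segment[OF compact_imp_closed[OF K(1)] IS(1)] by blast
    obtain b where b: "b \<in> K" "b \<in> closed_segment (Sup K) z" "open_segment b z \<inter> K = {}"
      using closed_nearest_on_segment[OF compact_imp_closed[OF K(1)] IS(2)] by blast
    have "a \<noteq> z" "b \<noteq> z" using a(1) b(1) z(3) by auto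
    then have az: "a < z" "z < b" using a(2) b(2) 3 by (auto simp: closed_segment_eq_real_ivl split: if_splits)
    then have "{a<..<b} \<subseteq> open_segment a z \<union> open_segment b z \<union> {z}"
      by (auto simp: open_segment_eq_real_ivl)
    then have "{a<..<b} \<inter> K = {}" using a(3) b(3) z(3) by blast
    moreover have "a \<le> c" "d \<le> b"
      using out[OF a(1)] out[OF b(1)] az z by linarith+
    ultimately show thesis using a(1) b(1) az by (intro that(3)) auto
  qed
qed

lemma vanishes_at_diagonalE:
  assumes "vanishes_at_diagonal K q" "\<epsilon> > 0"
  obtains \<delta> where "\<delta> > 0"
    "\<And>a b. a \<in> K \<Longrightarrow> b \<in> K \<Longrightarrow> 0 < \<bar>b - a\<bar> \<Longrightarrow> \<bar>b - a\<bar> < \<delta> \<Longrightarrow> \<bar>q a b\<bar> < \<epsilon>"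
proof -
  obtain \<delta> where "\<delta> > 0"
    and \<delta>: "\<forall>a\<in>K. \<forall>b\<in>K. 0 < \<bar>b - a\<bar> \<and> \<bar>b - a\<bar> < \<delta> \<longrightarrow> \<bar>q a b\<bar> < \<epsilon>"
    using assms(1)[unfolded vanishes_at_diagonal_def, rule_format, OF assms(2)] by (elim exE conjE)
  show thesis
    by (rule that[OF \<open>\<delta> > 0\<close>]) (simp add: \<delta>)
qed

text \<open>Freezing the base point in the uniform limit leaves differentiability relative to
  \<open>K\<close>.\<close>

lemma whitney_C1_has_vector_derivative:
  assumes W: "whitney_C1 K \<Gamma> \<Gamma>'" and x: "x \<in> K"
  shows "(\<Gamma> has_vector_derivative \<Gamma>' x) (at x within K)"
  unfolding has_vector_derivative_def has_derivative_within_alt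
proof (intro conjI allI impI)
  show "bounded_linear (\<lambda>h. h *\<^sub>R \<Gamma>' x)" by (rule bounded_linear_scaleR_left)
  fix \<epsilon> :: real assume "\<epsilon> > 0"
  have "vanishes_at_diagonal K (\<lambda>a b. norm (\<Gamma> b - \<Gamma> a - (b - a) *\<^sub>R \<Gamma>' a) / \<bar>b - a\<bar>)"
    using W by (simp add: whitney_C1_def)
  then obtain \<delta> where \<delta>: "\<delta> > 0" "\<And>a y. a \<in> K \<Longrightarrow> y \<in> K \<Longrightarrow> 0 < \<bar>y - a\<bar> \<Longrightarrow> \<bar>y - a\<bar> < \<delta> \<Longrightarrow>
      \<bar>norm (\<Gamma> y - \<Gamma> a - (y - a) *\<^sub>R \<Gamma>' a) / \<bar>y - a\<bar>\<bar> < \<epsilon>"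
    using \<open>\<epsilon> > 0\<close> by (rule vanishes_at_diagonalE) (rule that)
  have "norm (\<Gamma> y - \<Gamma> x - (y - x) *\<^sub>R \<Gamma>' x) \<le> \<epsilon> * norm (y - x)" if "y \<in> K" "norm (y - x) < \<delta>" for y
    using \<delta>(2)[OF x that(1)] that(2) by (cases "y = x") (simp_all add: pos_divide_less_eq)
  then show "\<exists>d>0. \<forall>y\<in>K. norm (y - x) < d \<longrightarrow> norm (\<Gamma> y - \<Gamma> x - (y - x) *\<^sub>R \<Gamma>' x) \<le> \<epsilon> * norm (y - x)"
    using \<delta>(1) by blast
qed

section \<open>Extension of Whitney data to a horizontal curve\<close>

context symplectic_form
begin

theorem horizontal_whitney_extension:
  assumes K: "compact K" and F: "whitney_C1 K F F'"
    and h: "\<And>s. s \<in> K \<Longrightarrow> (h has_vector_derivative \<omega> (F' s) (F s)) (at s within K)"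
    and area: "vanishes_at_diagonal K (\<lambda>a b. \<bar>h b - h a - \<omega> (F b) (F a)\<bar> / \<bar>b - a\<bar>\<^sup>2)"
  obtains f f' k where "continuous_on UNIV f'"
    "\<And>s. (f has_vector_derivative f' s) (at s)"
    "\<And>s. (k has_vector_derivative \<omega> (f' s) (f s)) (at s)"
    "\<And>s. s \<in> K \<Longrightarrow> f s = F s \<and> f' s = F' s \<and> k s = h s"
proof (cases "K = {}")
  case True
  \<comment> \<open>For empty \<open>K\<close> the values \<open>Inf K\<close> and
    \<open>Sup K\<close> mean nothing, and a constant curve does.\<close>
  show thesis
    by (rule that[of "\<lambda>_. 0" "\<lambda>_. 0" "\<lambda>_. 0"]) (simp_all add: True zero_left)
next
  case False
  have contF': "continuous_on K F'" using F by (simp add: whitney_C1_def)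
  have closedK: "closed K" using K by (rule compact_imp_closed)
  \<comment> \<open>\<open>R\<close> and \<open>A\<close> are the \<open>\<rho>\<close> and
    \<open>\<alpha>\<close> of the gap. For short gaps \<open>R\<close> is small by the Whitney
    condition and uniform continuity of \<open>F'\<close>, and \<open>A\<close> is small by the area
    condition.\<close>
  define R where "R a b = norm ((F b - F a) /\<^sub>R (b - a) - F' a) + norm (F' b - F' a)" for a b
  define A where "A a b = (h b - h a - \<omega> (F b) (F a)) / (b - a)\<^sup>2" for a b
  obtain C where C: "C > 0" and between: "\<And>a b p q v w x y \<rho> \<alpha>. a < b \<Longrightarrow> \<rho> = norm ((q - p) /\<^sub>R (b - a) - v) + norm (w - v) \<Longrightarrow>
      \<alpha> = (y - x - \<omega> q p) / (b - a)\<^sup>2 \<Longrightarrow>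
      \<exists>f f' k. f a = p \<and> f b = q \<and> f' a = v \<and> f' b = w \<and> k a = x \<and> k b = y \<and>
        continuous_on UNIV f' \<and> (\<forall>s. (f has_vector_derivative f' s) (at s)) \<and>
        (\<forall>s\<in>{a..b}. (k has_vector_derivative \<omega> (f' s) (f s)) (at s within {a..b})) \<and>
        (\<forall>s\<in>{a..b}. norm (f' s - v) \<le> C * (\<rho> + sqrt (\<bar>\<alpha>\<bar> + \<rho> * (norm v + \<rho>))))"
    by (rule horizontal_curve_between) (rule that)
  define Q where "Q a b f f' k \<longleftrightarrow> f a = F a \<and> f b = F b \<and> f' a = F' a \<and> f' b = F' b \<and> k a = h a \<and> k b = h b \<and>
        continuous_on UNIV f' \<and> (\<forall>s. (f has_vector_derivative f' s) (at s)) \<and>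
        (\<forall>s\<in>{a..b}. (k has_vector_derivative \<omega> (f' s) (f s)) (at s within {a..b})) \<and>
        (\<forall>s\<in>{a..b}. norm (f' s - F' a) \<le> C * (R a b + sqrt (\<bar>A a b\<bar> + R a b * (norm (F' a) + R a b))))"
    for a b f f' k
  \<comment> \<open>With the premise inside the existential, choice yields functions
    \<open>G\<close>, \<open>G'\<close>, \<open>H\<close> defined for all pairs.\<close>
  have "\<exists>f f' k. a < b \<longrightarrow> Q a b f f' k" for a b
    unfolding Q_def
    using between[OF _ R_def A_def] by blast
  then obtain G G' H where GH: "\<And>a b. a < b \<Longrightarrow> Q a b (G a b) (G' a b) (H a b)" by metis
  define f where "f = patch K F (\<lambda>s. F (Inf K) + (s - Inf K) *\<^sub>R F' (Inf K))
    (\<lambda>s. F (Sup K) + (s - Sup K) *\<^sub>R F' (Sup K)) G"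
  define f' where "f' = patch K F' (\<lambda>_. F' (Inf K)) (\<lambda>_. F' (Sup K)) G'"
  define k where "k = patch K h (\<lambda>s. h (Inf K) + (s - Inf K) *\<^sub>R \<omega> (F' (Inf K)) (F (Inf K)))
    (\<lambda>s. h (Sup K) + (s - Sup K) *\<^sub>R \<omega> (F' (Sup K)) (F (Sup K))) H"
  have on_K: "f s = F s" "f' s = F' s" "k s = h s" if "s \<in> K" for s
    using that by (simp_all add: f_def f'_def k_def patch_def)
  have on_gap: "f s = G a b s" "f' s = G' a b s" "k s = H a b s"
    if "a \<in> K" "b \<in> K" "a < b" "{a<..<b} \<inter> K = {}" "s \<in> {a..b}" for a b s
    unfolding f_def f'_def k_def using GH[OF \<open>a < b\<close>] that
    by (intro patch_gap[OF K False]; simp add: Q_def)+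
  have affine: "((\<lambda>s. p + (s - c) *\<^sub>R v) has_vector_derivative v) (at s within X)" for p v :: "'b::real_normed_vector" and c s X
  proof -
    have "((\<lambda>s. p + (s - c) *\<^sub>R v) has_vector_derivative 0 + 1 *\<^sub>R v) (at s within X)"
      by (intro has_vector_derivative_add has_vector_derivative_const has_vector_derivative_scaleR_const)
        (auto intro!: derivative_eq_intros)
    then show ?thesis by simp
  qed
  \<comment> \<open>Since \<open>\<omega> v v = 0\<close>, the height derivative is constant along a
    line. Outside the hull of \<open>K\<close> the extension therefore continues with constant
    velocity and affine height.\<close>
  have affine_horizontal: "\<omega> v (p + t *\<^sub>R v) = \<omega> v p" for v p t
    by (simp add: add_right scaleR_right)
  \<comment> \<open>Treats the two unbounded sides and the bounded gaps uniformly: \<open>J\<close>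
    is the closed component, and on it the three patched functions agree with one regular
    triple.\<close>
  have piece: "\<exists>J f0 f0' k0. {c..d} \<subseteq> J \<and> (\<forall>s\<in>J. f s = f0 s \<and> f' s = f0' s \<and> k s = k0 s) \<and>
      continuous_on J f0' \<and> (\<forall>s\<in>J. (f0 has_vector_derivative f0' s) (at s within J) \<and>
        (k0 has_vector_derivative \<omega> (f0' s) (f0 s)) (at s within J))"
    if cd: "c < d" "{c<..<d} \<inter> K = {}" for c d
    using gap_cases[OF K False cd]
  proof cases
    case 1
    have "f s = F (Inf K) + (s - Inf K) *\<^sub>R F' (Inf K)" "f' s = F' (Inf K)"
      "k s = h (Inf K) + (s - Inf K) *\<^sub>R \<omega> (F' (Inf K)) (F (Inf K))" if "s \<le> Inf K" for s
      unfolding f_def f'_def k_def by (rule patch_left[OF K False]; use that in simp)+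
    then show ?thesis
      using 1
      by (intro exI[of _ "{..Inf K}"] exI[of _ "\<lambda>s. F (Inf K) + (s - Inf K) *\<^sub>R F' (Inf K)"] exI[of _ "\<lambda>_. F' (Inf K)"]
          exI[of _ "\<lambda>s. h (Inf K) + (s - Inf K) *\<^sub>R \<omega> (F' (Inf K)) (F (Inf K))"] conjI ballI)
        (simp_all only: affine_horizontal affine continuous_on_const atMost_iff atLeast_iff subset_iff atLeastAtMost_iff order_trans, simp_all)
  next
    case 2
    have "f s = F (Sup K) + (s - Sup K) *\<^sub>R F' (Sup K)" "f' s = F' (Sup K)"
      "k s = h (Sup K) + (s - Sup K) *\<^sub>R \<omega> (F' (Sup K)) (F (Sup K))" if "Sup K \<le> s" for s
      unfolding f_def f'_def k_def by (rule patch_right[OF K False]; use that in simp)+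
    then show ?thesis
      using 2
      by (intro exI[of _ "{Sup K..}"] exI[of _ "\<lambda>s. F (Sup K) + (s - Sup K) *\<^sub>R F' (Sup K)"] exI[of _ "\<lambda>_. F' (Sup K)"]
          exI[of _ "\<lambda>s. h (Sup K) + (s - Sup K) *\<^sub>R \<omega> (F' (Sup K)) (F (Sup K))"] conjI ballI)
        (simp_all only: affine_horizontal affine continuous_on_const atMost_iff atLeast_iff subset_iff atLeastAtMost_iff order_trans, simp_all)
  next
    case (3 a b)
    have "Q a b (G a b) (G' a b) (H a b)" using GH \<open>a < b\<close> by blast
    then show ?thesis
      using 3(5,6) on_gap[OF 3(1-4)] unfolding Q_def
      by (intro exI[of _ "{a..b}"] exI[of _ "G a b"] exI[of _ "G' a b"] exI[of _ "H a b"] conjI ballI)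
        (simp_all add: has_vector_derivative_at_within continuous_on_subset[OF _ subset_UNIV])
  qed
  have gap_f': "continuous_on {c..d} f'" if cd: "c < d" "{c<..<d} \<inter> K = {}" for c d
  proof -
    obtain J f0' where J: "{c..d} \<subseteq> J" "\<And>s. s \<in> J \<Longrightarrow> f' s = f0' s" "continuous_on J f0'"
      using piece[OF cd] by blast
    have "continuous_on J f'" using J(3) by (rule continuous_on_eq) (simp add: J(2))
    then show ?thesis using J(1) by (rule continuous_on_subset)
  qed
  have gap_f: "(f has_vector_derivative f' s) (at s within {c..d})"
    and gap_k: "(k has_vector_derivative \<omega> (f' s) (f s)) (at s within {c..d})"
    if cd: "c < d" "{c<..<d} \<inter> K = {}" and s: "s \<in> {c..d}" for c d s
  proof -
    obtain J f0 f0' k0 where J: "{c..d} \<subseteq> J" "\<And>s. s \<in> J \<Longrightarrow> f s = f0 s \<and> f' s = f0' s \<and> k s = k0 s"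
      "\<And>s. s \<in> J \<Longrightarrow> (f0 has_vector_derivative f0' s) (at s within J)"
      "\<And>s. s \<in> J \<Longrightarrow> (k0 has_vector_derivative \<omega> (f0' s) (f0 s)) (at s within J)"
      using piece[OF cd] by blast
    have sJ: "s \<in> J" using s J(1) by blast
    have "(f has_vector_derivative f' s) (at s within J)"
      using has_vector_derivative_transform[OF sJ _ J(3)[OF sJ], of f] J(2) sJ by simp
    then show "(f has_vector_derivative f' s) (at s within {c..d})"
      by (rule has_vector_derivative_within_subset[OF _ J(1)])
    have "(k has_vector_derivative \<omega> (f' s) (f s)) (at s within J)"
      using has_vector_derivative_transform[OF sJ _ J(4)[OF sJ], of k] J(2) sJ by simp
    then show "(k has_vector_derivative \<omega> (f' s) (f s)) (at s within {c..d})"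
      by (rule has_vector_derivative_within_subset[OF _ J(1)])
  qed
  obtain M where M: "M > 0" "\<And>s. s \<in> K \<Longrightarrow> norm (F' s) \<le> M"
    using compact_imp_bounded[OF compact_continuous_image[OF contF' K]] by (auto simp: bounded_pos)
  have small: "\<exists>\<delta>>0. \<forall>a\<in>K. \<forall>b\<in>K. a < b \<longrightarrow> b < a + \<delta> \<longrightarrow> {a<..<b} \<inter> K = {} \<longrightarrow>
      (\<forall>s\<in>{a..b}. dist (f' s) (f' a) < \<epsilon>)" if \<epsilon>: "\<epsilon> > 0" for \<epsilon>
  proof -
    \<comment> \<open>\<open>\<psi> t\<close> bounds the deviation of the velocity over a gap with
      \<open>R \<le> t + t\<close> and \<open>\<bar>A\<bar> \<le> t\<close>; the two summands of
      \<open>R\<close> give one \<open>t\<close> each. As \<open>\<psi>\<close> is continuous with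
      \<open>\<psi> 0 = 0\<close>, some positive \<open>t\<close> brings it below
      \<open>\<epsilon>\<close>.\<close>
    define \<psi> where "\<psi> t = C * (t + t + sqrt (t + (t + t) * (M + (t + t))))" for t
    have "isCont \<psi> 0" unfolding \<psi>_def[abs_def] by (intro continuous_intros)
    then obtain d where d: "d > 0" "\<And>t. dist t 0 < d \<Longrightarrow> dist (\<psi> t) (\<psi> 0) < \<epsilon>"
      using \<epsilon> unfolding continuous_at_eps_delta by blast
    define t where "t = d / 2"
    have t: "t > 0" "\<psi> t < \<epsilon>" using d(1) d(2)[of t] by (auto simp: t_def \<psi>_def dist_real_def)
    have "vanishes_at_diagonal K (\<lambda>a b. norm (F b - F a - (b - a) *\<^sub>R F' a) / \<bar>b - a\<bar>)"
      using F by (simp add: whitney_C1_def)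
    then obtain d1 where d1: "d1 > 0" "\<And>a b. a \<in> K \<Longrightarrow> b \<in> K \<Longrightarrow> 0 < \<bar>b - a\<bar> \<Longrightarrow> \<bar>b - a\<bar> < d1 \<Longrightarrow>
        \<bar>norm (F b - F a - (b - a) *\<^sub>R F' a) / \<bar>b - a\<bar>\<bar> < t"
      using t(1) by (rule vanishes_at_diagonalE) (rule that)
    obtain d2 where d2: "d2 > 0" "\<And>a b. a \<in> K \<Longrightarrow> b \<in> K \<Longrightarrow> dist b a < d2 \<Longrightarrow> dist (F' b) (F' a) < t"
      using compact_uniformly_continuous[OF contF' K] t(1) unfolding uniformly_continuous_on_def by blast
    obtain d3 where d3: "d3 > 0" "\<And>a b. a \<in> K \<Longrightarrow> b \<in> K \<Longrightarrow> 0 < \<bar>b - a\<bar> \<Longrightarrow> \<bar>b - a\<bar> < d3 \<Longrightarrow>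
        \<bar>\<bar>h b - h a - \<omega> (F b) (F a)\<bar> / \<bar>b - a\<bar>\<^sup>2\<bar> < t"
      using area t(1) by (rule vanishes_at_diagonalE) (rule that)
    have "dist (f' s) (f' a) < \<epsilon>"
      if ab: "a \<in> K" "b \<in> K" "a < b" "b < a + min d1 (min d2 d3)" "{a<..<b} \<inter> K = {}" and s: "s \<in> {a..b}"
      for a b s
    proof -
      have short: "b - a < d1" "b - a < d2" "b - a < d3" using ab(4) by simp_all
      have "(F b - F a) /\<^sub>R (b - a) - F' a = (F b - F a - (b - a) *\<^sub>R F' a) /\<^sub>R (b - a)"
        using ab(3) by (simp add: scaleR_diff_right)
      then have "norm ((F b - F a) /\<^sub>R (b - a) - F' a) \<le> t"
        using d1(2)[OF ab(1,2)] ab(3) short by (simp add: divide_inverse mult.commute)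
      moreover have "norm (F' b - F' a) \<le> t"
        using d2(2)[OF ab(1,2)] ab(3) short by (simp add: dist_norm[symmetric] dist_real_def)
      ultimately have R: "R a b \<le> t + t" "0 \<le> R a b" by (simp_all add: R_def)
      have "\<bar>A a b\<bar> \<le> t"
        using d3(2)[OF ab(1,2)] ab(3) short by (simp add: A_def)
      moreover have "norm (F' a) + R a b \<le> M + (t + t)" using M(2)[OF ab(1)] R(1) by simp
      then have "R a b * (norm (F' a) + R a b) \<le> (t + t) * (M + (t + t))"
        using t(1) R by (intro mult_mono) simp_all
      ultimately have "\<bar>A a b\<bar> + R a b * (norm (F' a) + R a b) \<le> t + (t + t) * (M + (t + t))"
        by (rule add_mono)
      then have "C * (R a b + sqrt (\<bar>A a b\<bar> + R a b * (norm (F' a) + R a b))) \<le> \<psi> t"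
        unfolding \<psi>_def using C by (intro mult_left_mono add_mono[OF R(1)] real_sqrt_le_mono) simp_all
      moreover have "norm (G' a b s - F' a) \<le> C * (R a b + sqrt (\<bar>A a b\<bar> + R a b * (norm (F' a) + R a b)))"
        using GH[OF ab(3)] s unfolding Q_def by blast
      ultimately show ?thesis
        using t(2) on_gap(2)[OF ab(1,2,3,5) s] on_K(2)[OF ab(1)] by (simp add: dist_norm)
    qed
    then show ?thesis
      using d1(1) d2(1) d3(1) by (intro exI[of _ "min d1 (min d2 d3)"]) auto
  qed
  have cont_f': "continuous_on UNIV f'"
  proof (rule continuous_on_glue[OF closedK])
    show "continuous_on K f'" using contF' on_K(2) by (simp cong: continuous_on_cong)
  qed (fact gap_f' small)+
  have f: "(f has_vector_derivative f' s) (at s)" for s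
  proof (rule has_vector_derivative_glue[OF closedK cont_f'])
    show "(f has_vector_derivative f' x) (at x within K)" if "x \<in> K" for x
      using has_vector_derivative_transform[OF that on_K(1) whitney_C1_has_vector_derivative[OF F that]] that
      by (simp add: on_K)
  qed (fact gap_f)
  \<comment> \<open>The height is glued last: gluing requires a continuous candidate derivative,
    which is available only once \<open>f\<close> and \<open>f'\<close> are known to be
    continuous.\<close>
  have "continuous_on UNIV f"
    using f by (auto intro!: continuous_at_imp_continuous_on has_vector_derivative_continuous)
  then have cont_k': "continuous_on UNIV (\<lambda>s. \<omega> (f' s) (f s))"
    by (rule continuous_on[OF cont_f'])
  have k: "(k has_vector_derivative \<omega> (f' s) (f s)) (at s)" for s
  proof (rule has_vector_derivative_glue[OF closedK cont_k'])
    show "(k has_vector_derivative \<omega> (f' x) (f x)) (at x within K)" if "x \<in> K" for x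
      using has_vector_derivative_transform[OF that on_K(3) h[OF that]] that by (simp add: on_K)
  qed (fact gap_k)
  show thesis by (rule that[OF cont_f' f k]) (simp add: on_K)
qed

end

section \<open>The Heisenberg group\<close>

text \<open>Twice the standard symplectic form, with the arguments ordered so that velocity comes
  before position in the horizontality equation; the same form evaluated at \<open>b\<close> and
  \<open>a\<close> appears in the area condition.\<close>

definition heisenberg_form :: "(real \<times> real) ^ 'n::finite \<Rightarrow> (real \<times> real) ^ 'n \<Rightarrow> real" where
  "heisenberg_form u v = 2 * (\<Sum>j\<in>UNIV. fst (u $ j) * snd (v $ j) - fst (v $ j) * snd (u $ j))"

interpretation heisenberg: symplectic_form "heisenberg_form :: (real \<times> real) ^ 'n::finite \<Rightarrow> _"
proof -
  have "bilinear (heisenberg_form :: (real \<times> real) ^ 'n \<Rightarrow> _)"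
    unfolding bilinear_def linear_iff heisenberg_form_def
    by (simp add: sum.distrib[symmetric] sum_distrib_left algebra_simps)
  then have 1: "bounded_bilinear (heisenberg_form :: (real \<times> real) ^ 'n \<Rightarrow> _)"
    by (simp add: bilinear_conv_bounded_bilinear)
  \<comment> \<open>The entry \<open>1 / 2\<close> cancels the factor 2 of the form.\<close>
  have "heisenberg_form (axis i (1::real, 0::real)) (axis i (0::real, 1 / 2 :: real)) = 1" for i :: 'n
  proof -
    have "fst (axis i (1::real, 0::real) $ j) * snd (axis i (0::real, 1 / 2 :: real) $ j)
        - fst (axis i (0::real, 1 / 2 :: real) $ j) * snd (axis i (1::real, 0::real) $ j) = (if j = i then 1 / 2 else (0::real))" for j
      by (simp add: axis_def)
    then show ?thesis by (simp add: heisenberg_form_def)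
  qed
  then have 2: "\<exists>e1 e2 :: (real \<times> real) ^ 'n. heisenberg_form e1 e2 = 1" by blast
  show "symplectic_form (heisenberg_form :: (real \<times> real) ^ 'n \<Rightarrow> _)"
    by (intro symplectic_form.intro 1 symplectic_form_axioms.intro 2) (simp add: heisenberg_form_def)
qed

lemma horizontal_space_iff_heisenberg_form:
  "v \<in> horizontal_space p \<longleftrightarrow> snd v = heisenberg_form (fst v) (fst p)"
  by (simp add: horizontal_space_iff t_coord_def x_coord_def y_coord_def heisenberg_form_def)

lemma whitney_C1_fst:
  assumes "whitney_C1 K \<Gamma> \<Gamma>'"
  shows "whitney_C1 K (\<lambda>s. fst (\<Gamma> s)) (\<lambda>s. fst (\<Gamma>' s))"
  unfolding whitney_C1_def vanishes_at_diagonal_def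
proof (intro conjI allI impI)
  show "continuous_on K (\<lambda>s. fst (\<Gamma> s))" "continuous_on K (\<lambda>s. fst (\<Gamma>' s))"
    using assms by (auto simp: whitney_C1_def intro: continuous_intros)
  fix \<epsilon> :: real assume "\<epsilon> > 0"
  have "vanishes_at_diagonal K (\<lambda>a b. norm (\<Gamma> b - \<Gamma> a - (b - a) *\<^sub>R \<Gamma>' a) / \<bar>b - a\<bar>)"
    using assms by (simp add: whitney_C1_def)
  then obtain \<delta> where \<delta>: "\<delta> > 0" "\<And>a b. a \<in> K \<Longrightarrow> b \<in> K \<Longrightarrow> 0 < \<bar>b - a\<bar> \<Longrightarrow> \<bar>b - a\<bar> < \<delta> \<Longrightarrow>
      \<bar>norm (\<Gamma> b - \<Gamma> a - (b - a) *\<^sub>R \<Gamma>' a) / \<bar>b - a\<bar>\<bar> < \<epsilon>"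
    using \<open>\<epsilon> > 0\<close> by (rule vanishes_at_diagonalE) (rule that)
  have le: "\<bar>norm (fst (\<Gamma> b) - fst (\<Gamma> a) - (b - a) *\<^sub>R fst (\<Gamma>' a)) / \<bar>b - a\<bar>\<bar>
      \<le> \<bar>norm (\<Gamma> b - \<Gamma> a - (b - a) *\<^sub>R \<Gamma>' a) / \<bar>b - a\<bar>\<bar>" for a b
  proof -
    have "norm (fst (\<Gamma> b - \<Gamma> a - (b - a) *\<^sub>R \<Gamma>' a)) \<le> norm (\<Gamma> b - \<Gamma> a - (b - a) *\<^sub>R \<Gamma>' a)"
      using norm_fst_le[of "fst (\<Gamma> b - \<Gamma> a - (b - a) *\<^sub>R \<Gamma>' a)" "snd (\<Gamma> b - \<Gamma> a - (b - a) *\<^sub>R \<Gamma>' a)"]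
      by (simp only: prod.collapse)
    then show ?thesis by (simp add: divide_right_mono)
  qed
  show "\<exists>\<delta>>0. \<forall>a\<in>K. \<forall>b\<in>K. 0 < \<bar>b - a\<bar> \<and> \<bar>b - a\<bar> < \<delta> \<longrightarrow>
      \<bar>norm (fst (\<Gamma> b) - fst (\<Gamma> a) - (b - a) *\<^sub>R fst (\<Gamma>' a)) / \<bar>b - a\<bar>\<bar> < \<epsilon>"
  proof (intro exI[of _ \<delta>] conjI ballI impI)
    fix a b assume ab: "a \<in> K" "b \<in> K" "0 < \<bar>b - a\<bar> \<and> \<bar>b - a\<bar> < \<delta>"
    show "\<bar>norm (fst (\<Gamma> b) - fst (\<Gamma> a) - (b - a) *\<^sub>R fst (\<Gamma>' a)) / \<bar>b - a\<bar>\<bar> < \<epsilon>"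
      using le \<delta>(2)[OF ab(1,2) conjunct1[OF ab(3)] conjunct2[OF ab(3)]] by (rule le_less_trans)
  qed (rule \<delta>)
qed

theorem theorem1p5:
  fixes K :: "real set" and \<Gamma> \<Gamma>' :: "real \<Rightarrow> 'n::finite heisenberg"
  assumes "compact K"
    and "whitney_C1 K \<Gamma> \<Gamma>'"
  shows "(\<exists>\<gamma>. horizontal_C1_curve \<gamma> \<and>
            (\<forall>s\<in>K. \<gamma> s = \<Gamma> s \<and> vector_derivative \<gamma> (at s) = \<Gamma>' s)) \<longleftrightarrow>
         vanishes_at_diagonal K
           (\<lambda>a b. \<bar>t_coord (\<Gamma> b) - t_coord (\<Gamma> a) -
                    2 * (\<Sum>j\<in>UNIV. x_coord j (\<Gamma> b) * y_coord j (\<Gamma> a) -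
                                    x_coord j (\<Gamma> a) * y_coord j (\<Gamma> b))\<bar> / \<bar>b - a\<bar>\<^sup>2) \<and>
         (\<forall>s\<in>K. t_coord (\<Gamma>' s) =
            2 * (\<Sum>j\<in>UNIV. x_coord j (\<Gamma>' s) * y_coord j (\<Gamma> s) -
                            y_coord j (\<Gamma>' s) * x_coord j (\<Gamma> s)))"
proof -
  have form: "2 * (\<Sum>j\<in>UNIV. x_coord j p * y_coord j q - x_coord j q * y_coord j p)
      = heisenberg_form (fst p) (fst q)" for p q :: "'n heisenberg"
    by (simp add: heisenberg_form_def x_coord_def y_coord_def)
  have form': "2 * (\<Sum>j\<in>UNIV. x_coord j p * y_coord j q - y_coord j p * x_coord j q)
      = heisenberg_form (fst p) (fst q)" for p q :: "'n heisenberg"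
    by (simp add: heisenberg_form_def x_coord_def y_coord_def mult.commute)
  show ?thesis
    unfolding form form' t_coord_def
  proof (intro iffI; (elim conjE exE)?)
    fix \<gamma> :: "real \<Rightarrow> 'n heisenberg"
    assume \<gamma>: "horizontal_C1_curve \<gamma>"
      and on_K: "\<forall>s\<in>K. \<gamma> s = \<Gamma> s \<and> vector_derivative \<gamma> (at s) = \<Gamma>' s"
    obtain \<gamma>' where \<gamma>': "\<And>s. (\<gamma> has_vector_derivative \<gamma>' s) (at s)" "continuous_on UNIV \<gamma>'"
      using \<gamma> unfolding horizontal_C1_curve_def C1_differentiable_on_def by blast
    have "vector_derivative \<gamma> (at s) = \<gamma>' s" for s
      by (rule vector_derivative_at[OF \<gamma>'(1)])
    then have hor: "snd (\<gamma>' s) = heisenberg_form (fst (\<gamma>' s)) (fst (\<gamma> s))"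
      and on_K': "s \<in> K \<Longrightarrow> \<gamma> s = \<Gamma> s \<and> \<gamma>' s = \<Gamma>' s" for s
      using \<gamma> on_K unfolding horizontal_C1_curve_def horizontal_space_iff_heisenberg_form by simp_all
    have "vanishes_at_diagonal K (\<lambda>a b. \<bar>snd (\<gamma> b) - snd (\<gamma> a) - heisenberg_form (fst (\<gamma> b)) (fst (\<gamma> a))\<bar> / \<bar>b - a\<bar>\<^sup>2)"
    proof (rule heisenberg.horizontal_vanishes_at_diagonal[OF \<open>compact K\<close>, where f' = "\<lambda>s. fst (\<gamma>' s)"])
      show "continuous_on UNIV (\<lambda>s. fst (\<gamma>' s))" using \<gamma>'(2) by (intro continuous_intros)
      show "((\<lambda>s. fst (\<gamma> s)) has_vector_derivative fst (\<gamma>' s)) (at s)" for s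
        using bounded_linear.has_vector_derivative[OF bounded_linear_fst \<gamma>'(1)] .
      show "((\<lambda>s. snd (\<gamma> s)) has_vector_derivative heisenberg_form (fst (\<gamma>' s)) (fst (\<gamma> s))) (at s)" for s
        using bounded_linear.has_vector_derivative[OF bounded_linear_snd \<gamma>'(1)] by (simp add: hor)
    qed
    then have "vanishes_at_diagonal K (\<lambda>a b. \<bar>snd (\<Gamma> b) - snd (\<Gamma> a) - heisenberg_form (fst (\<Gamma> b)) (fst (\<Gamma> a))\<bar> / \<bar>b - a\<bar>\<^sup>2)"
      unfolding vanishes_at_diagonal_def using on_K by simp
    moreover have "\<forall>s\<in>K. snd (\<Gamma>' s) = heisenberg_form (fst (\<Gamma>' s)) (fst (\<Gamma> s))"
      using hor on_K' by metis
    ultimately show "vanishes_at_diagonal K (\<lambda>a b. \<bar>snd (\<Gamma> b) - snd (\<Gamma> a) - heisenberg_form (fst (\<Gamma> b)) (fst (\<Gamma> a))\<bar> / \<bar>b - a\<bar>\<^sup>2)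
        \<and> (\<forall>s\<in>K. snd (\<Gamma>' s) = heisenberg_form (fst (\<Gamma>' s)) (fst (\<Gamma> s)))" ..
  next
    assume area: "vanishes_at_diagonal K (\<lambda>a b. \<bar>snd (\<Gamma> b) - snd (\<Gamma> a) - heisenberg_form (fst (\<Gamma> b)) (fst (\<Gamma> a))\<bar> / \<bar>b - a\<bar>\<^sup>2)"
      and hor: "\<forall>s\<in>K. snd (\<Gamma>' s) = heisenberg_form (fst (\<Gamma>' s)) (fst (\<Gamma> s))"
    \<comment> \<open>The last component of the Whitney condition differentiates the height along
      \<open>K\<close>, and the pointwise condition identifies that derivative with the
      form.\<close>
    have deriv: "((\<lambda>s. snd (\<Gamma> s)) has_vector_derivative heisenberg_form (fst (\<Gamma>' s)) (fst (\<Gamma> s))) (at s within K)"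
      if "s \<in> K" for s
      using bounded_linear.has_vector_derivative[OF bounded_linear_snd
          whitney_C1_has_vector_derivative[OF \<open>whitney_C1 K \<Gamma> \<Gamma>'\<close> that]] hor that by simp
    obtain f f' k where ext: "continuous_on UNIV f'"
      "\<And>s. (f has_vector_derivative f' s) (at s)"
      "\<And>s. (k has_vector_derivative heisenberg_form (f' s) (f s)) (at s)"
      "\<And>s. s \<in> K \<Longrightarrow> f s = fst (\<Gamma> s) \<and> f' s = fst (\<Gamma>' s) \<and> k s = snd (\<Gamma> s)"
      by (rule heisenberg.horizontal_whitney_extension[OF \<open>compact K\<close> whitney_C1_fst[OF \<open>whitney_C1 K \<Gamma> \<Gamma>'\<close>] _ area])
        (rule deriv, assumption, rule that)
    define \<gamma> where "\<gamma> s = (f s, k s)" for s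
    \<comment> \<open>The height component is horizontal by construction; on \<open>K\<close> it
      agrees with that of \<open>\<Gamma>'\<close> by the pointwise condition
      \<open>hor\<close>.\<close>
    define \<gamma>' where "\<gamma>' s = (f' s, heisenberg_form (f' s) (f s))" for s
    have \<gamma>': "(\<gamma> has_vector_derivative \<gamma>' s) (at s)" for s
      unfolding \<gamma>_def[abs_def] \<gamma>'_def by (intro has_vector_derivative_Pair ext)
    have "continuous_on UNIV f"
      using ext(2) by (auto intro!: continuous_at_imp_continuous_on has_vector_derivative_continuous)
    then have "continuous_on UNIV \<gamma>'"
      unfolding \<gamma>'_def[abs_def] by (intro continuous_on_Pair ext(1) heisenberg.continuous_on)
    then have "\<gamma> C1_differentiable_on UNIV"
      unfolding C1_differentiable_on_def using \<gamma>' by blast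
    moreover have vd: "vector_derivative \<gamma> (at s) = \<gamma>' s" for s
      by (rule vector_derivative_at[OF \<gamma>'])
    ultimately have "horizontal_C1_curve \<gamma>"
      by (simp add: horizontal_C1_curve_def horizontal_space_iff_heisenberg_form \<gamma>_def \<gamma>'_def)
    moreover have "\<forall>s\<in>K. \<gamma> s = \<Gamma> s \<and> vector_derivative \<gamma> (at s) = \<Gamma>' s"
      using ext(4) hor by (simp add: vd \<gamma>_def \<gamma>'_def prod_eq_iff)
    ultimately show "\<exists>\<gamma>. horizontal_C1_curve \<gamma> \<and> (\<forall>s\<in>K. \<gamma> s = \<Gamma> s \<and> vector_derivative \<gamma> (at s) = \<Gamma>' s)"
      by blast
  qed
qed

end
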